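(* Let $G=(V,E)$ be a transient, locally finite network, let $x\in V$, and let $X$ be a random walk on $G$ started from $x$. Then $$\mathbb{E}\big[\mathrm{Cap}(\mathsf{LE}(X^n))\big]\ge\frac{1}{256}\,\mathbb{E}\big[\mathrm{Cap}(X^n)\big]$$ for every integer $n\ge0$.
   Context: A network is an infinite connected graph $G=(V,E)$ with positive edge conductances $(c_e)_{e\in E}$; for $x\in V$, $c(x)$ is the total conductance of the oriented edges emanating from $x$, and the random walk on $G$ at a vertex crosses an edge emanating from it with probability proportional to its conductance. $\mathbb{P}_x$ is the law of the walk started at $x$. For a finite set $A\subseteq V$, $\tau_A^+=\min\{t\ge1:X_t\in A\}$ (with $\min\emptyset=\infty$) and the capacity is $\mathrm{Cap}(A)=\sum_{x\in A}c(x)\mathbb{P}_x(\tau_A^+=\infty)$. $X^n=(X_0,\dots,X_n)$ is the walk run for $n$ steps. The loop-erasure $\mathsf{LE}(w)$ of a finite path $w=(w_0,\dots,w_m)$ is obtained by erasing cycles chronologically: $\ell_0=0$, $\ell_{i+1}=1+\max\{k: w_k=w_{\ell_i}\}$, terminating the first time that $\max\{k:w_k=w_{\ell_i}\}=m$, and $\mathsf{LE}(w)_i=w_{\ell_i}$. A path is identified with the set of vertices it visits when its capacity is taken. *)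

theory Defs
  imports "HOL-Probability.Probability" "Graph_Theory.Graph_Theory"
begin

text \<open>
  Graphs may have loops and parallel edges.  An unoriented edge is a pair \<open>{a, arev a}\<close> of oppositely
  oriented arcs of a digraph; both arcs carry the conductance of the edge.  (So a loop contributes
  twice its conductance to the total conductance at its endpoint; a loop counted only once is
  obtained by halving its conductance, which gives the same walk.)
\<close>

locale network = bidirected_digraph G arev
  for G :: "('v, 'e) pre_digraph" and arev :: "'e \<Rightarrow> 'e" +
  fixes c :: "'e \<Rightarrow> real"
  assumes infinite_verts: "infinite (verts G)"
    and graph_connected: "Digraph_Component.connected G"
    and conductance_pos: "a \<in> arcs G \<Longrightarrow> c a > 0"
    and conductance_arev: "a \<in> arcs G \<Longrightarrow> c (arev a) = c a"

definition locally_finite :: "('v, 'e) pre_digraph \<Rightarrow> bool" where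
  "locally_finite G \<longleftrightarrow> (\<forall>v\<in>verts G. finite (out_arcs G v))"

definition total_conductance :: "('v, 'e) pre_digraph \<Rightarrow> ('e \<Rightarrow> real) \<Rightarrow> 'v \<Rightarrow> real" where
  "total_conductance G c v = (\<Sum>a\<in>out_arcs G v. c a)"

text \<open>The probability that the arc crossed from \<open>v\<close> leads to \<open>w\<close>.\<close>

definition transition :: "('v, 'e) pre_digraph \<Rightarrow> ('e \<Rightarrow> real) \<Rightarrow> 'v \<Rightarrow> 'v \<Rightarrow> real" where
  "transition G c v w = (\<Sum>a | a \<in> out_arcs G v \<and> head G a = w. c a / total_conductance G c v)"

text \<open>
  The law of the walk started at \<open>x\<close>, on the space of sequences of vertices, is obtained from its
  one-step conditional laws by the Ionescu-Tulcea theorem: \<open>walk_kernel G c x n \<omega>\<close> is the law of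
  the position at time \<open>n\<close> given the positions \<open>\<omega> 0, \<dots>, \<omega> (n - 1)\<close>.  The walk itself is the
  coordinate process \<open>\<omega> \<mapsto> \<omega> t\<close>; see \<open>walk_law_cylinder\<close> below for its finite-dimensional laws.
\<close>

definition walk_kernel ::
    "('v, 'e) pre_digraph \<Rightarrow> ('e \<Rightarrow> real) \<Rightarrow> 'v \<Rightarrow> nat \<Rightarrow> (nat \<Rightarrow> 'v) \<Rightarrow> 'v measure" where
  "walk_kernel G c x n \<omega> = (case n of
      0 \<Rightarrow> return (count_space (verts G)) x
    | Suc k \<Rightarrow> point_measure (verts G) (\<lambda>w. ennreal (transition G c (\<omega> k) w)))"

definition walk_law :: "('v, 'e) pre_digraph \<Rightarrow> ('e \<Rightarrow> real) \<Rightarrow> 'v \<Rightarrow> (nat \<Rightarrow> 'v) measure" where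
  "walk_law G c x = projective_family.lim UNIV
     (Ionescu_Tulcea.CI (walk_kernel G c x) (\<lambda>_. count_space (verts G)))
     (\<lambda>_. count_space (verts G))"

text \<open>The infimum of the empty set in \<^typ>\<open>enat\<close> is \<open>\<infinity>\<close>.\<close>

definition return_time :: "'v set \<Rightarrow> (nat \<Rightarrow> 'v) \<Rightarrow> enat" where
  "return_time A \<omega> = (INF t\<in>{t. t \<ge> 1 \<and> \<omega> t \<in> A}. enat t)"

definition escape_prob :: "('v, 'e) pre_digraph \<Rightarrow> ('e \<Rightarrow> real) \<Rightarrow> 'v \<Rightarrow> 'v set \<Rightarrow> real" where
  "escape_prob G c x A =
     measure (walk_law G c x) {\<omega> \<in> space (walk_law G c x). return_time A \<omega> = \<infinity>}"

definition transient :: "('v, 'e) pre_digraph \<Rightarrow> ('e \<Rightarrow> real) \<Rightarrow> bool" where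
  "transient G c \<longleftrightarrow> (\<forall>v\<in>verts G. escape_prob G c v {v} > 0)"

definition Cap :: "('v, 'e) pre_digraph \<Rightarrow> ('e \<Rightarrow> real) \<Rightarrow> 'v set \<Rightarrow> real" where
  "Cap G c A = (\<Sum>x\<in>A. total_conductance G c x * escape_prob G c x A)"

definition walk_path :: "nat \<Rightarrow> (nat \<Rightarrow> 'v) \<Rightarrow> 'v list" where
  "walk_path n \<omega> = map \<omega> [0..<Suc n]"

text \<open>
  A path \<open>(w\<^sub>0, \<dots>, w\<^sub>m)\<close> is a list of length \<open>m + 1\<close>.  The indices \<open>le_index w i\<close> have a meaning
  only for \<open>i \<le> le_end w\<close>.
\<close>

definition last_visit :: "'v list \<Rightarrow> nat \<Rightarrow> nat" where
  "last_visit w j = Max {k. k < length w \<and> w ! k = w ! j}"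

primrec le_index :: "'v list \<Rightarrow> nat \<Rightarrow> nat" where
  "le_index w 0 = 0"
| "le_index w (Suc i) = 1 + last_visit w (le_index w i)"

definition le_end :: "'v list \<Rightarrow> nat" where
  "le_end w = (LEAST i. last_visit w (le_index w i) = length w - 1)"

definition LE :: "'v list \<Rightarrow> 'v list" where
  "LE w = map (\<lambda>i. w ! le_index w i) [0..<Suc (le_end w)]"


context network
begin

context
  assumes lf: "locally_finite G"
begin

lemma out_arcs_nonempty:
  assumes v: "v \<in> verts G" shows "out_arcs G v \<noteq> {}"
proof -
  from infinite_verts have "infinite (verts G - {v})" by simp
  then obtain u where u: "u \<in> verts G" "u \<noteq> v"
    by (metis DiffE finite.emptyI insertI1 ex_in_conv)
  have "v \<rightarrow>\<^sup>*\<^bsub>mk_symmetric G\<^esub> u"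
    using graph_connected v u unfolding Digraph_Component.connected_def strongly_connected_def by simp
  then obtain w where "v \<rightarrow>\<^bsub>mk_symmetric G\<^esub> w"
    using u(2) by (cases rule: pre_digraph.converse_reachable_cases) auto
  then obtain a where "a \<in> arcs G" "tail G a = v \<or> head G a = v"
    by (auto simp: parcs_mk_symmetric)
  then have "a \<in> out_arcs G v \<or> arev a \<in> out_arcs G v"
    by (auto simp: out_arcs_def)
  then show ?thesis by blast
qed

lemma total_conductance_pos:
  assumes v: "v \<in> verts G" shows "total_conductance G c v > 0"
  unfolding total_conductance_def
  using v lf out_arcs_nonempty[OF v]
  by (intro sum_pos conductance_pos) (auto simp: locally_finite_def out_arcs_def)

lemma transition_nonneg:
  assumes v: "v \<in> verts G" shows "transition G c v w \<ge> 0"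
  unfolding transition_def using total_conductance_pos[OF v]
  by (intro sum_nonneg divide_nonneg_pos) (auto simp: out_arcs_def intro: less_imp_le conductance_pos)

lemma prob_space_step:
  assumes v: "v \<in> verts G"
  shows "prob_space (point_measure (verts G) (\<lambda>w. ennreal (transition G c v w)))"
proof (rule prob_spaceI)
  let ?H = "head G ` out_arcs G v"
  have fin: "finite (out_arcs G v)" using lf v by (auto simp: locally_finite_def)
  have zero: "transition G c v w = 0" if "w \<notin> ?H" for w
    unfolding transition_def using that by (intro sum.neutral) auto
  have sub: "{w \<in> verts G. 0 < ennreal (transition G c v w)} \<subseteq> ?H"
    using zero by force
  have "emeasure (point_measure (verts G) (\<lambda>w. ennreal (transition G c v w))) (verts G)
      = (\<Sum>w | w \<in> verts G \<and> 0 < ennreal (transition G c v w). ennreal (transition G c v w))"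
    using finite_subset[OF sub] fin by (intro emeasure_point_measure) auto
  also have "\<dots> = (\<Sum>w\<in>?H. ennreal (transition G c v w))"
    using sub fin
    by (intro sum.mono_neutral_left)
       (auto simp: out_arcs_def zero_less_iff_neq_zero simp del: ennreal_eq_0_iff ennreal_less_zero_iff)
  also have "\<dots> = ennreal (\<Sum>w\<in>?H. transition G c v w)"
    using transition_nonneg[OF v] by (simp add: sum_ennreal)
  also have "(\<Sum>w\<in>?H. transition G c v w) = (\<Sum>a\<in>out_arcs G v. c a / total_conductance G c v)"
    unfolding transition_def using sum.image_gen[OF fin, of "\<lambda>a. c a / total_conductance G c v" "head G"]
    by simp
  also have "\<dots> = 1"
    using total_conductance_pos[OF v]
    by (simp add: sum_divide_distrib[symmetric] total_conductance_def[symmetric])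
  finally show "emeasure (point_measure (verts G) (\<lambda>w. ennreal (transition G c v w)))
      (space (point_measure (verts G) (\<lambda>w. ennreal (transition G c v w)))) = 1"
    by (simp add: space_point_measure)
qed

context
  fixes x assumes x: "x \<in> verts G"
begin

lemma Ionescu_Tulcea_walk: "Ionescu_Tulcea (walk_kernel G c x) (\<lambda>_. count_space (verts G))"
proof (rule Ionescu_Tulcea.intro)
  fix n :: nat
  show "walk_kernel G c x n \<in> PiM {0..<n} (\<lambda>_. count_space (verts G)) \<rightarrow>\<^sub>M
      subprob_algebra (count_space (verts G))"
  proof (cases n)
    case 0
    have "return (count_space (verts G)) x \<in> space (subprob_algebra (count_space (verts G)))"
      using x by (auto simp: space_subprob_algebra
          intro!: prob_space_imp_subprob_space prob_space_return)
    moreover have "walk_kernel G c x n = (\<lambda>_. return (count_space (verts G)) x)"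
      by (simp add: 0 walk_kernel_def fun_eq_iff)
    ultimately show ?thesis by (simp only: measurable_const)
  next
    case (Suc k)
    have comp: "(\<lambda>\<omega>. \<omega> k) \<in> PiM {0..<n} (\<lambda>_. count_space (verts G)) \<rightarrow>\<^sub>M count_space (verts G)"
      using Suc by (intro measurable_component_singleton) auto
    have "(\<lambda>v. point_measure (verts G) (\<lambda>w. ennreal (transition G c v w)))
        \<in> count_space (verts G) \<rightarrow>\<^sub>M subprob_algebra (count_space (verts G))"
      by (auto simp: space_subprob_algebra sets_point_measure
          intro!: prob_space_imp_subprob_space prob_space_step)
    from measurable_compose[OF comp this]
    have "(\<lambda>\<omega>. point_measure (verts G) (\<lambda>w. ennreal (transition G c (\<omega> k) w)))
        \<in> PiM {0..<n} (\<lambda>_. count_space (verts G)) \<rightarrow>\<^sub>M subprob_algebra (count_space (verts G))" .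
    moreover have "walk_kernel G c x n =
        (\<lambda>\<omega>. point_measure (verts G) (\<lambda>w. ennreal (transition G c (\<omega> k) w)))"
      by (simp add: Suc walk_kernel_def fun_eq_iff)
    ultimately show ?thesis by simp
  qed
next
  fix n :: nat and \<omega> :: "nat \<Rightarrow> 'v"
  assume "\<omega> \<in> space (PiM {0..<n} (\<lambda>_. count_space (verts G)))"
  then show "prob_space (walk_kernel G c x n \<omega>)"
    using x by (cases n)
      (auto simp: walk_kernel_def space_PiM PiE_iff intro!: prob_space_return prob_space_step)
qed

interpretation IT: Ionescu_Tulcea "walk_kernel G c x" "\<lambda>_. count_space (verts G)"
  by (rule Ionescu_Tulcea_walk)

lemma sets_walk_law: "sets (walk_law G c x) = sets (PiM UNIV (\<lambda>_. count_space (verts G)))"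
  unfolding walk_law_def by (rule IT.PF.sets_lim)

lemma space_walk_law: "space (walk_law G c x) = {\<omega>. \<forall>t. \<omega> t \<in> verts G}"
  unfolding walk_law_def IT.PF.space_lim by (auto simp: space_PiM)

lemma cylinder_C:
  assumes w: "\<And>i. w i \<in> verts G"
  shows "emeasure (IT.C 0 (Suc n) (\<lambda>_. undefined)) {restrict w {0..<Suc n}}
    = ennreal (if w 0 = x then (\<Prod>i<n. transition G c (w i) (w (Suc i))) else 0)"
proof -
  let ?M = "\<lambda>_::nat. count_space (verts G)"
  have sing: "{restrict w {0..<k}} \<in> sets (PiM {0..<k} ?M)" for k
  proof -
    have "{restrict w {0..<k}} = (\<Pi>\<^sub>E i\<in>{0..<k}. {w i})"
      by (rule PiE_singleton[symmetric, THEN trans, OF restrict_extensional]) (auto intro!: PiE_cong)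
    also have "\<dots> \<in> sets (PiM {0..<k} ?M)"
      using w by (intro sets_PiM_I_finite) auto
    finally show ?thesis .
  qed
  have u: "(\<lambda>_. undefined) \<in> space (PiM {0..<0} ?M)" by (simp add: space_PiM)
  have bind: "emeasure (IT.C 0 (Suc n) (\<lambda>_. undefined)) {restrict w {0..<Suc n}}
    = (\<integral>\<^sup>+ \<omega>. emeasure (walk_kernel G c x n (restrict w {0..<n})) {w n}
        * indicator {restrict w {0..<n}} \<omega> \<partial>IT.C 0 n (\<lambda>_. undefined))" for n
  proof -
    have ne: "space (IT.C 0 n (\<lambda>_. undefined)) \<noteq> {}"
      using IT.space_C[OF u, of n] w by (auto simp: space_PiM PiE_eq_empty_iff)
    have mb: "IT.eP n \<in> IT.C 0 n (\<lambda>_. undefined) \<rightarrow>\<^sub>M subprob_algebra (PiM {0..<Suc n} ?M)"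
      using IT.measurable_eP[of n]
        measurable_cong_sets[OF IT.sets_C[OF u, of n, unfolded add_0], of "subprob_algebra (PiM {0..<Suc n} ?M)"]
      by blast
    have "emeasure (IT.C 0 (Suc n) (\<lambda>_. undefined)) {restrict w {0..<Suc n}}
      = (\<integral>\<^sup>+ \<omega>. emeasure (IT.eP n \<omega>) {restrict w {0..<Suc n}} \<partial>IT.C 0 n (\<lambda>_. undefined))"
      using emeasure_bind[OF ne mb sing] by simp
    also have "\<dots> = (\<integral>\<^sup>+ \<omega>. emeasure (walk_kernel G c x n (restrict w {0..<n})) {w n}
        * indicator {restrict w {0..<n}} \<omega> \<partial>IT.C 0 n (\<lambda>_. undefined))"
    proof (rule nn_integral_cong)
      fix \<omega> assume "\<omega> \<in> space (IT.C 0 n (\<lambda>_. undefined))"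
      then have \<omega>: "\<omega> \<in> space (PiM {0..<n} ?M)" using IT.space_C[OF u, of n] by simp
      have "(\<lambda>y. fun_upd \<omega> n y) -` {restrict w {0..<Suc n}} \<inter> verts G
          = (if \<omega> = restrict w {0..<n} then {w n} else {})"
      proof -
        have upd: "fun_upd \<omega> n y = restrict w {0..<Suc n} \<longleftrightarrow> \<omega> = restrict w {0..<n} \<and> y = w n" for y
        proof
          assume eq: "fun_upd \<omega> n y = restrict w {0..<Suc n}"
          have "\<omega> i = restrict w {0..<n} i" for i
          proof (cases "i < n")
            case True then show ?thesis using fun_cong[OF eq, of i] by simp
          next
            case False then show ?thesis using \<omega> by (auto simp: space_PiM PiE_def extensional_def)
          qed
          then show "\<omega> = restrict w {0..<n} \<and> y = w n" using fun_cong[OF eq, of n] by auto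
        qed (auto simp: fun_eq_iff)
        show ?thesis unfolding vimage_def singleton_iff upd using w by auto
      qed
      then show "emeasure (IT.eP n \<omega>) {restrict w {0..<Suc n}} =
          emeasure (walk_kernel G c x n (restrict w {0..<n})) {w n} * indicator {restrict w {0..<n}} \<omega>"
        by (simp add: IT.emeasure_eP[OF \<omega> sing])
    qed
    finally show ?thesis .
  qed
  have step: "emeasure (IT.C 0 (Suc n) (\<lambda>_. undefined)) {restrict w {0..<Suc n}}
    = emeasure (walk_kernel G c x n (restrict w {0..<n})) {w n}
        * emeasure (IT.C 0 n (\<lambda>_. undefined)) {restrict w {0..<n}}" for n
    unfolding bind using sing[of n] IT.sets_C[OF u, of n] by (subst nn_integral_cmult_indicator) auto
  show ?thesis
  proof (induction n)
    case 0
    show ?case unfolding step[of 0] using w x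
      by (auto simp: walk_kernel_def restrict_def emeasure_return PiM_empty indicator_def)
  next
    case (Suc n)
    have k: "emeasure (walk_kernel G c x (Suc n) (restrict w {0..<Suc n})) {w (Suc n)}
        = ennreal (transition G c (w n) (w (Suc n)))"
    proof -
      have "{a. a = w (Suc n) \<and> 0 < ennreal (transition G c (w n) a)}
          = (if 0 < ennreal (transition G c (w n) (w (Suc n))) then {w (Suc n)} else {})" by auto
      then show ?thesis
        using w by (simp add: walk_kernel_def emeasure_point_measure) (auto simp: not_less ennreal_neg)
    qed
    show ?case unfolding step[of "Suc n"] k Suc.IH
      using w transition_nonneg
      by (auto simp: ennreal_mult'' [symmetric] ennreal_mult[symmetric] prod_nonneg mult.commute)
  qed
qed

lemma prob_space_walk_law: "prob_space (walk_law G c x)"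
proof (rule prob_spaceI)
  let ?M = "\<lambda>_::nat. count_space (verts G)"
  have "emeasure (walk_law G c x) (prod_emb UNIV ?M {} {\<lambda>_. undefined}) = IT.CI {} {\<lambda>_. undefined}"
    unfolding walk_law_def by (rule IT.lim) (auto simp: PiM_empty)
  also have "\<dots> = 1"
    using prob_space.emeasure_space_1[OF IT.PF.prob_space_P[of "{}"]] 
    by (simp add: IT.PF.space_P space_PiM)
  also have "prod_emb UNIV ?M {} {\<lambda>_. undefined} = space (walk_law G c x)"
    by (auto simp: prod_emb_def space_walk_law restrict_def PiE_iff)
  finally show "emeasure (walk_law G c x) (space (walk_law G c x)) = 1" .
qed

lemma walk_law_cylinder:
  assumes w: "\<And>i. w i \<in> verts G"
  shows "measure (walk_law G c x) {\<omega> \<in> space (walk_law G c x). \<forall>i\<le>n. \<omega> i = w i}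
    = (if w 0 = x then (\<Prod>i<n. transition G c (w i) (w (Suc i))) else 0)"
proof -
  let ?M = "\<lambda>_::nat. count_space (verts G)"
  let ?J = "{0..<Suc n}"
  have "{restrict w ?J} = (\<Pi>\<^sub>E i\<in>?J. {w i})"
    by (rule PiE_singleton[symmetric, THEN trans, OF restrict_extensional]) (auto intro!: PiE_cong)
  also have "\<dots> \<in> sets (PiM ?J ?M)"
    using w by (intro sets_PiM_I_finite) auto
  finally have sing: "{restrict w ?J} \<in> sets (PiM ?J ?M)" .
  have "{\<omega> \<in> space (walk_law G c x). \<forall>i\<le>n. \<omega> i = w i} = prod_emb UNIV ?M ?J {restrict w ?J}"
    by (auto simp: prod_emb_def space_walk_law PiE_iff fun_eq_iff restrict_def less_Suc_eq_le split: if_splits)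
  then have "emeasure (walk_law G c x) {\<omega> \<in> space (walk_law G c x). \<forall>i\<le>n. \<omega> i = w i}
      = IT.CI ?J {restrict w ?J}"
    unfolding walk_law_def using sing by (simp add: IT.lim)
  also have "\<dots> = emeasure (IT.C 0 (Suc n) (\<lambda>_. undefined)) {restrict w ?J}"
    using sing w by (subst IT.emeasure_CI[of _ "Suc n"]) (auto simp: prod_emb_id space_PiM)
  also note cylinder_C[OF w, of n]
  finally show ?thesis
    using w transition_nonneg by (simp add: measure_def prod_nonneg)
qed

end

end

end

end

theory Submission
  imports Defs
begin

text \<open>
  Write \<open>K = LE (X\<^sup>n)\<close>, let \<open>g\<close> be the symmetric Green function and \<open>e\<^sub>A\<close> the equilibrium measure of \<open>A\<close>.
  Since \<open>g\<close> is positive semidefinite and \<open>g e\<^sub>K\<close> is the probability \<open>h\<^sub>K\<close> of hitting \<open>K\<close>, expanding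
  \<open>\<langle>e\<^sub>K - s \<nu>, g (e\<^sub>K - s \<nu>)\<rangle> \<ge> 0\<close> gives \<open>Cap K \<ge> 2 s \<langle>\<nu>, h\<^sub>K\<rangle> - s\<^sup>2 \<langle>\<nu>, g \<nu>\<rangle>\<close> for every measure \<open>\<nu>\<close>.
  Take \<open>\<nu> = \<Sum>m\<le>n. M\<^sub>m \<delta>(X\<^sub>m)\<close>, where \<open>M\<^sub>m\<close> is the conditional expectation given \<open>X\<^sub>0, \<dots>, X\<^sub>m\<close> of the
  equilibrium charge of \<open>X\<^sup>n\<close> at \<open>X\<^sub>m\<close>, counted at first visits only.  With \<open>C = E (Cap (X\<^sup>n))\<close>:

  \<^item> The expected mass of \<open>\<nu>\<close> is \<open>C\<close>, and its expected energy is at most \<open>2 C\<close>: for \<open>m \<le> l\<close> one may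
    replace \<open>M\<^sub>l\<close> by the charge itself, and the potential of the charge is at most 1.

  \<^item> Given \<open>X\<^sub>0, \<dots>, X\<^sub>m\<close>, an independent walk from \<open>X\<^sub>m\<close> hits \<open>K\<close> with probability at least 1/2
    (Lyons, Peres and Schramm): by symmetry, with probability at least 1/2 it meets
    \<open>LE (X\<^sub>0, \<dots>, X\<^sub>m)\<close> at a point no later than the first one that the future of \<open>X\<close> revisits, and
    such a point is not erased.

  With \<open>s = 1/4\<close> this yields \<open>E (Cap K) \<ge> C / 8\<close>.
\<close>

subsection \<open>Loop erasure\<close>

lemma
  assumes "j < length w"
  shows last_visit_less: "last_visit w j < length w"
    and nth_last_visit: "w ! last_visit w j = w ! j"
    and last_visit_ge: "j \<le> last_visit w j"
proof -
  let ?S = "{k. k < length w \<and> w ! k = w ! j}"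
  have "finite ?S" "j \<in> ?S" using assms by auto
  then have "last_visit w j \<in> ?S" "j \<le> last_visit w j"
    unfolding last_visit_def using Max_in[of ?S] Max_ge[of ?S j] by blast+
  then show "last_visit w j < length w" "w ! last_visit w j = w ! j" "j \<le> last_visit w j"
    by auto
qed

lemma last_visit_append:
  assumes "k < length s" "s ! k \<notin> set t"
  shows "last_visit (s @ t) k = last_visit s k"
proof -
  have "{i. i < length (s @ t) \<and> (s @ t) ! i = (s @ t) ! k} = {i. i < length s \<and> s ! i = s ! k}"
    using assms by (auto simp: nth_append in_set_conv_nth)
      (metis add_diff_inverse_nat add_less_cancel_left)
  then show ?thesis by (simp add: last_visit_def)
qed

text \<open>The \<open>LEAST\<close> in \<open>le_end\<close> needs a witness: as long as the end of
  the list is not reached, the indices strictly increase, so they cannot stay below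
  \<open>length w\<close> forever.\<close>

lemma last_visit_le_end:
  assumes "w \<noteq> []"
  shows "last_visit w (le_index w (le_end w)) = length w - 1"
proof -
  have "\<exists>i. last_visit w (le_index w i) = length w - 1"
  proof (rule ccontr)
    assume never: "\<not> ?thesis"
    have "le_index w i < length w \<and> i \<le> le_index w i" for i
    proof (induction i)
      case (Suc i)
      then have "last_visit w (le_index w i) < length w" "le_index w i \<le> last_visit w (le_index w i)"
        by (simp_all add: last_visit_less last_visit_ge)
      moreover have "last_visit w (le_index w i) \<noteq> length w - 1" using never by blast
      ultimately show ?case using Suc by simp
    qed (use assms in simp)
    from this[of "length w"] show False by linarith
  qed
  then show ?thesis unfolding le_end_def by (rule LeastI_ex)
qed

lemma le_index_less:
  assumes "w \<noteq> []" "i \<le> le_end w"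
  shows "le_index w i < length w"
  using assms(2)
proof (induction i)
  case (Suc i)
  then have "last_visit w (le_index w i) < length w"
    by (intro last_visit_less) simp
  moreover have "last_visit w (le_index w i) \<noteq> length w - 1"
    using Suc.prems not_less_Least[of i] unfolding le_end_def by (metis Suc_le_lessD)
  ultimately show ?case by simp
qed (use assms in simp)

lemma length_LE: "length (LE w) = Suc (le_end w)"
  by (simp add: LE_def)

lemma LE_nth: "i \<le> le_end w \<Longrightarrow> LE w ! i = w ! le_index w i"
  by (simp add: LE_def del: upt_Suc)

lemma set_LE_subset: "w \<noteq> [] \<Longrightarrow> set (LE w) \<subseteq> set w"
  by (auto simp: LE_def le_index_less simp del: upt_Suc)

lemma last_LE:
  assumes "w \<noteq> []" shows "last (LE w) = last w"
proof -
  have "last (LE w) = w ! le_index w (le_end w)"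
    by (simp add: LE_def)
  also have "\<dots> = w ! last_visit w (le_index w (le_end w))"
    using assms by (simp add: nth_last_visit le_index_less)
  finally show ?thesis using assms by (simp add: last_visit_le_end last_conv_nth)
qed

text \<open>The last visits to the vertices before index \<open>j\<close> all lie in
  \<open>s\<close>, so both erasures use the same indices up to \<open>j\<close>. For nonempty
  \<open>t\<close> the erasure of \<open>s @ t\<close> cannot stop before \<open>j\<close>, since
  its final position lies in \<open>t\<close>. Visits of \<open>t\<close> to \<open>LE s ! j\<close>
  itself do no harm.\<close>

lemma LE_append_keeps:
  assumes s: "s \<noteq> []" and j: "j \<le> le_end s" and avoids: "\<And>i. i < j \<Longrightarrow> LE s ! i \<notin> set t"
  shows "LE s ! j \<in> set (LE (s @ t))"
proof (cases "t = []")
  case True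
  then show ?thesis using j by (simp add: length_LE)
next
  case False
  have visit: "last_visit (s @ t) (le_index s i) = last_visit s (le_index s i)" if "i < j" for i
    using that j avoids[OF that] s by (intro last_visit_append le_index_less) (auto simp: LE_nth)
  have index: "le_index (s @ t) i = le_index s i" if "i \<le> j" for i
    using that by (induction i) (simp_all add: visit)
  have "j \<le> le_end (s @ t)"
  proof (rule ccontr)
    assume "\<not> ?thesis"
    then have i: "le_end (s @ t) < j" by simp
    have "length (s @ t) - 1 = last_visit s (le_index s (le_end (s @ t)))"
      using last_visit_le_end[of "s @ t"] s i by (simp add: index visit)
    also have "\<dots> < length s"
      using i j s by (intro last_visit_less le_index_less) simp_all
    finally show False using False by (cases t) auto
  qed
  then have "LE s ! j = LE (s @ t) ! j"
    using j s by (simp add: LE_nth index nth_append le_index_less)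
  then show ?thesis using \<open>j \<le> le_end (s @ t)\<close> by (simp add: length_LE)
qed

text \<open>The value is meaningful only if \<open>L\<close> meets \<open>A\<close>. In the
  application both sets that are compared contain \<open>last s\<close>, which is also the last
  vertex of \<open>LE s\<close>.\<close>

definition first_hit :: "'v list \<Rightarrow> 'v set \<Rightarrow> nat" where
  "first_hit L A = (LEAST i. i < length L \<and> L ! i \<in> A)"

text \<open>A path that meets the loop-erasure of \<open>s\<close> no later than the continuation of \<open>s\<close> does meets
  it at a point that the continuation does not erase.\<close>

lemma hit_LE_append:
  assumes s: "s \<noteq> []" and q: "q \<noteq> []" and B: "last s \<in> B"
    and le: "first_hit (LE s) B \<le> first_hit (LE s) (set q)"
  shows "B \<inter> set (LE (s @ tl q)) \<noteq> {}"
proof -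
  let ?j = "first_hit (LE s) B"
  have "LE s \<noteq> []" using length_LE[of s] by auto
  then have "le_end s < length (LE s) \<and> LE s ! le_end s \<in> B"
    using B last_LE[OF s] last_conv_nth[of "LE s"] by (simp add: length_LE)
  then have j: "?j < length (LE s) \<and> LE s ! ?j \<in> B"
    unfolding first_hit_def by (rule LeastI)
  have "LE s ! i \<notin> set (tl q)" if "i < ?j" for i
    using not_less_Least[of i "\<lambda>i. i < length (LE s) \<and> LE s ! i \<in> set q"] that le j
      list.set_sel(2)[OF q]
    unfolding first_hit_def[symmetric] by fastforce
  with j have "LE s ! ?j \<in> set (LE (s @ tl q))"
    by (intro LE_append_keeps s) (simp_all add: length_LE)
  with j show ?thesis by blast
qed

subsection \<open>Finite paths of the walk\<close>

locale locally_finite_network = network +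
  assumes locally_finite_verts: "locally_finite G"
begin

abbreviation weight :: "'a \<Rightarrow> real" where
  "weight \<equiv> total_conductance G c"

text \<open>The transition operator P of the walk. Summing over arcs instead of vertices allows
  reversibility to be used arc by arc.\<close>

definition step :: "('a \<Rightarrow> real) \<Rightarrow> 'a \<Rightarrow> real" where
  "step f v = (\<Sum>a\<in>out_arcs G v. c a / weight v * f (head G a))"

abbreviation steps :: "nat \<Rightarrow> ('a \<Rightarrow> real) \<Rightarrow> 'a \<Rightarrow> real" where
  "steps k \<equiv> step ^^ k"

definition neighbors :: "'a \<Rightarrow> 'a set" where
  "neighbors v = head G ` out_arcs G v"

primrec paths :: "nat \<Rightarrow> 'a \<Rightarrow> 'a list set" where
  "paths 0 v = {[v]}"
| "paths (Suc n) v = (\<Union>w\<in>neighbors v. (#) v ` paths n w)"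

text \<open>Expectation along the first \<open>n\<close> steps. The recursion on the first step
  makes linearity, monotonicity and the Markov property plain inductions;
  \<open>integral_walk_path\<close> links it to \<open>walk_law\<close>.\<close>

primrec wexp :: "nat \<Rightarrow> 'a \<Rightarrow> ('a list \<Rightarrow> real) \<Rightarrow> real" where
  "wexp 0 v F = F [v]"
| "wexp (Suc n) v F = step (\<lambda>w. wexp n w (\<lambda>p. F (v # p))) v"

lemma finite_out_arcs: "v \<in> verts G \<Longrightarrow> finite (out_arcs G v)"
  using locally_finite_verts by (simp add: locally_finite_def)

lemma weight_pos: "v \<in> verts G \<Longrightarrow> weight v > 0"
  using total_conductance_pos[OF locally_finite_verts] .

lemma finite_neighbors: "v \<in> verts G \<Longrightarrow> finite (neighbors v)"
  by (simp add: neighbors_def finite_out_arcs)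

lemma neighbors_verts: "w \<in> neighbors v \<Longrightarrow> w \<in> verts G"
  by (auto simp: neighbors_def)

section \<open>The transition operator and its powers\<close>

lemma step_add: "step (\<lambda>w. f w + g w) v = step f v + step g v"
  by (simp add: step_def algebra_simps sum.distrib)

lemma step_diff: "step (\<lambda>w. f w - g w) v = step f v - step g v"
  by (simp add: step_def algebra_simps sum_subtractf)

lemma step_cmult: "step (\<lambda>w. a * f w) v = a * step f v"
  by (simp add: step_def sum_distrib_left mult.left_commute)

lemma step_zero: "step (\<lambda>w. 0) v = 0"
  by (simp add: step_def)

lemma step_sum: "step (\<lambda>w. \<Sum>i\<in>I. f i w) v = (\<Sum>i\<in>I. step (f i) v)"
  unfolding step_def sum_distrib_left by (rule sum.swap)

lemma step_one: "v \<in> verts G \<Longrightarrow> step (\<lambda>w. 1) v = 1"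
  using weight_pos[of v]
  by (simp add: step_def total_conductance_def flip: sum_divide_distrib)

lemma step_mono:
  assumes "v \<in> verts G" "\<And>w. w \<in> neighbors v \<Longrightarrow> f w \<le> g w"
  shows "step f v \<le> step g v"
  unfolding step_def using assms weight_pos[of v]
  by (intro sum_mono mult_left_mono divide_nonneg_pos less_imp_le[OF conductance_pos])
     (auto simp: neighbors_def)

lemma step_cong: "(\<And>w. w \<in> neighbors v \<Longrightarrow> f w = g w) \<Longrightarrow> step f v = step g v"
  unfolding step_def by (intro sum.cong) (auto simp: neighbors_def)

text \<open>Grouping the arcs by their heads connects the operator with \<open>transition\<close>,
  from which \<open>walk_law\<close> is built.\<close>

lemma step_transition:
  assumes "v \<in> verts G"
  shows "step f v = (\<Sum>w\<in>neighbors v. transition G c v w * f w)"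
proof -
  have "step f v = (\<Sum>w\<in>neighbors v. \<Sum>a | a \<in> out_arcs G v \<and> head G a = w.
      c a / weight v * f (head G a))"
    unfolding step_def neighbors_def by (rule sum.image_gen[OF finite_out_arcs[OF assms]])
  also have "\<dots> = (\<Sum>w\<in>neighbors v. transition G c v w * f w)"
    unfolding transition_def sum_distrib_right by (intro sum.cong refl) auto
  finally show ?thesis .
qed

lemma step_tendsto:
  assumes "\<And>w. w \<in> neighbors v \<Longrightarrow> (\<lambda>N. f N w) \<longlonglongrightarrow> g w"
  shows "(\<lambda>N. step (f N) v) \<longlonglongrightarrow> step g v"
  unfolding step_def using assms by (intro tendsto_intros) (auto simp: neighbors_def)

lemma steps_Suc: "steps (Suc k) f = steps k (step f)"
  by (simp add: funpow_swap1)

lemma steps_diff: "steps k (\<lambda>w. f w - g w) = (\<lambda>v. steps k f v - steps k g v)"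
  by (induction k) (auto simp: step_diff)

lemma steps_cmult: "steps k (\<lambda>w. a * f w) = (\<lambda>v. a * steps k f v)"
  by (induction k) (auto simp: step_cmult)

lemma steps_sum: "steps k (\<lambda>w. \<Sum>i\<in>I. f i w) = (\<lambda>v. \<Sum>i\<in>I. steps k (f i) v)"
  by (induction k) (auto simp: step_sum)

lemma steps_one: "v \<in> verts G \<Longrightarrow> steps k (\<lambda>w. 1) v = 1"
proof (induction k arbitrary: v)
  case (Suc k)
  have "step (steps k (\<lambda>w. 1)) v = step (\<lambda>w. 1) v"
    by (intro step_cong Suc.IH neighbors_verts)
  then show ?case using step_one[OF Suc.prems] by simp
qed simp

lemma steps_mono:
  assumes "\<And>w. w \<in> verts G \<Longrightarrow> f w \<le> g w" and "v \<in> verts G"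
  shows "steps k f v \<le> steps k g v"
  using assms(2)
  by (induction k arbitrary: v) (auto intro: assms(1) step_mono neighbors_verts)

lemma steps_cong:
  assumes "\<And>w. w \<in> verts G \<Longrightarrow> f w = g w" and "v \<in> verts G"
  shows "steps k f v = steps k g v"
  using steps_mono[of f g v k] steps_mono[of g f v k] assms by (simp add: order.antisym)

lemma steps_nonneg:
  assumes "\<And>w. w \<in> verts G \<Longrightarrow> 0 \<le> f w" and "v \<in> verts G"
  shows "0 \<le> steps k f v"
  using steps_mono[of "\<lambda>_. 0" f v k] assms steps_cmult[of k 0 f] by simp

lemma steps_tendsto:
  assumes "\<And>w. w \<in> verts G \<Longrightarrow> (\<lambda>N. f N w) \<longlonglongrightarrow> g w" and "v \<in> verts G"
  shows "(\<lambda>N. steps k (f N) v) \<longlonglongrightarrow> steps k g v"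
  using assms(2)
proof (induction k arbitrary: v)
  case (Suc k)
  show ?case unfolding funpow.simps comp_def
    by (intro step_tendsto Suc.IH neighbors_verts)
qed (simp add: assms(1))

section \<open>Paths of fixed length and expectations along them\<close>

lemma finite_paths: "v \<in> verts G \<Longrightarrow> finite (paths n v)"
  by (induction n arbitrary: v) (auto simp: finite_neighbors neighbors_verts)

lemma paths_nonempty: "[] \<notin> paths n v"
  by (cases n) auto

lemma paths_Cons: "p \<in> paths n v \<Longrightarrow> v # tl p = p"
  by (cases n) auto

lemma length_paths: "p \<in> paths n v \<Longrightarrow> length p = Suc n"
  by (induction n arbitrary: v p) auto

lemma set_paths: "v \<in> verts G \<Longrightarrow> p \<in> paths n v \<Longrightarrow> set p \<subseteq> verts G"
  proof (induction n arbitrary: v p)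
  case (Suc n)
  then show ?case using neighbors_verts by (auto simp: subset_iff; metis)
qed simp

lemma nth_paths_verts: "v \<in> verts G \<Longrightarrow> p \<in> paths n v \<Longrightarrow> m \<le> n \<Longrightarrow> p ! m \<in> verts G"
  using set_paths[of v p n] length_paths[of p n v] by auto

lemma wexp_mono:
  assumes "v \<in> verts G" "\<And>p. p \<in> paths n v \<Longrightarrow> F p \<le> H p"
  shows "wexp n v F \<le> wexp n v H"
  using assms
proof (induction n arbitrary: v F H)
  case (Suc n)
  have "wexp n w (\<lambda>p. F (v # p)) \<le> wexp n w (\<lambda>p. H (v # p))" if "w \<in> neighbors v" for w
    using that Suc.prems(2) by (intro Suc.IH neighbors_verts[OF that]) auto
  then show ?case by (simp add: step_mono Suc.prems)
qed auto

lemma wexp_cong: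
  assumes "\<And>p. p \<in> paths n v \<Longrightarrow> F p = H p"
  shows "wexp n v F = wexp n v H"
  using assms
proof (induction n arbitrary: v F H)
  case (Suc n)
  have "wexp n w (\<lambda>p. F (v # p)) = wexp n w (\<lambda>p. H (v # p))" if "w \<in> neighbors v" for w
    using that Suc.prems by (intro Suc.IH) auto
  then show ?case by (simp cong: step_cong)
qed auto

lemma wexp_add: "wexp n v (\<lambda>p. F p + H p) = wexp n v F + wexp n v H"
  by (induction n arbitrary: v F H) (simp_all add: step_add)

lemma wexp_diff: "wexp n v (\<lambda>p. F p - H p) = wexp n v F - wexp n v H"
  by (induction n arbitrary: v F H) (simp_all add: step_diff)

lemma wexp_cmult: "wexp n v (\<lambda>p. a * F p) = a * wexp n v F"
  by (induction n arbitrary: v F) (simp_all add: step_cmult)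

lemma wexp_sum: "wexp n v (\<lambda>p. \<Sum>i\<in>I. F i p) = (\<Sum>i\<in>I. wexp n v (F i))"
  by (induction n arbitrary: v F) (simp_all add: step_sum)

lemma wexp_const: "v \<in> verts G \<Longrightarrow> wexp n v (\<lambda>p. a) = a"
proof (induction n arbitrary: v)
  case (Suc n)
  have "step (\<lambda>w. wexp n w (\<lambda>p. a)) v = step (\<lambda>w. a * 1) v"
    by (rule step_cong) (simp add: Suc.IH neighbors_verts)
  then show ?case using step_one[OF Suc.prems] by (simp only: wexp.simps step_cmult)
qed simp

lemma wexp_nonneg:
  assumes "v \<in> verts G" "\<And>p. p \<in> paths n v \<Longrightarrow> 0 \<le> F p"
  shows "0 \<le> wexp n v F"
  using wexp_mono[of v n "\<lambda>_. 0" F] assms wexp_const[of v n 0] by simp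

lemma wexp_tendsto:
  assumes "\<And>p. p \<in> paths n v \<Longrightarrow> (\<lambda>N. F N p) \<longlonglongrightarrow> H p"
  shows "(\<lambda>N. wexp n v (F N)) \<longlonglongrightarrow> wexp n v H"
  using assms
proof (induction n arbitrary: v F H)
  case (Suc n)
  have "(\<lambda>N. wexp n w (\<lambda>p. F N (v # p))) \<longlonglongrightarrow> wexp n w (\<lambda>p. H (v # p))"
    if "w \<in> neighbors v" for w
    using that Suc.prems by (intro Suc.IH) auto
  then show ?case by (simp add: step_tendsto)
qed auto

lemma wexp_step: "wexp n v (\<lambda>p. step (\<lambda>w. F w p) u) = step (\<lambda>w. wexp n v (F w)) u"
  unfolding step_def wexp_sum wexp_cmult ..

text \<open>Fubini for two independent walks; the symmetry argument in
  \<open>wexp_hit_LE_ge_half\<close> rests on it.\<close>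

lemma wexp_swap: "wexp n v (\<lambda>p. wexp m u (F p)) = wexp m u (\<lambda>q. wexp n v (\<lambda>p. F p q))"
  by (induction m arbitrary: u F) (simp_all add: wexp_step)

text \<open>The Markov property at time \<open>m\<close>. The second piece \<open>q\<close> starts
  at \<open>last s\<close>, so its first vertex is dropped when the pieces are joined.\<close>

lemma wexp_append:
  "wexp (m + k) v F = wexp m v (\<lambda>s. wexp k (last s) (\<lambda>q. F (s @ tl q)))"
proof (induction m arbitrary: v F)
  case 0
  show ?case by (auto intro!: wexp_cong simp: paths_Cons)
next
  case (Suc m)
  have "wexp m w (\<lambda>s. wexp k (last s) (\<lambda>q. F (v # s @ tl q))) =
      wexp m w (\<lambda>s. wexp k (last (v # s)) (\<lambda>q. F ((v # s) @ tl q)))" for w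
    using paths_nonempty[of m w] by (intro wexp_cong) auto
  then show ?case by (simp add: Suc.IH)
qed

text \<open>The conditional expectation of \<open>F\<close> given the first \<open>m\<close> steps, as a function of the path.\<close>

definition wcond :: "nat \<Rightarrow> nat \<Rightarrow> ('a list \<Rightarrow> real) \<Rightarrow> 'a list \<Rightarrow> real" where
  "wcond n m F p = wexp (n - m) (p ! m) (\<lambda>q. F (take (Suc m) p @ tl q))"

lemma wcond_take: "m \<le> l \<Longrightarrow> wcond n m F (take (Suc l) p) = wcond n m F p"
  by (simp add: wcond_def min_absorb1)

text \<open>The tower property. The hypothesis on \<open>A\<close> says that \<open>A\<close> is
  determined by the first \<open>m\<close> steps, so it is constant in the inner expectation of the
  Markov decomposition.\<close>

lemma wexp_wcond:
  assumes m: "m \<le> n" and v: "v \<in> verts G" and A: "\<And>p. A (take (Suc m) p) = A p"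
  shows "wexp n v (\<lambda>p. A p * wcond n m F p) = wexp n v (\<lambda>p. A p * F p)"
proof -
  have split: "wexp n v H = wexp m v (\<lambda>s. wexp (n - m) (last s) (\<lambda>q. H (s @ tl q)))" for H
    using wexp_append[of m "n - m" v H] m by simp
  have *: "A (s @ q) = A s \<and> wcond n m F (s @ q) = wexp (n - m) (last s) (\<lambda>q. F (s @ tl q))
      \<and> last s \<in> verts G" if "s \<in> paths m v" for s q
    using length_paths[OF that] set_paths[OF v that] A[of "s @ q"] A[of s] last_in_set[of s]
      paths_nonempty[of m v] that
    by (cases "s = []") (auto simp: wcond_def nth_append last_conv_nth)
  show ?thesis unfolding split
    by (rule wexp_cong) (simp add: * wexp_const wexp_cmult)
qed

text \<open>The weights are the cylinder probabilities of \<open>walk_law_cylinder\<close>. Paths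
  with different second vertices are distinct, so the recursion unfolds into a disjoint sum.\<close>

lemma wexp_eq_sum_paths:
  assumes "v \<in> verts G"
  shows "wexp n v F = (\<Sum>p\<in>paths n v. (\<Prod>i<n. transition G c (p ! i) (p ! Suc i)) * F p)"
  using assms
proof (induction n arbitrary: v F)
  case (Suc n)
  let ?t = "transition G c"
  have hd: "p ! 0 = w" if "p \<in> paths n w" for p w
    using paths_Cons[OF that] by (metis nth_Cons_0)
  have disj: "(#) v ` paths n w \<inter> (#) v ` paths n w' = {}" if "w \<noteq> w'" for w w'
    using that by (auto dest!: hd)
  have "wexp (Suc n) v F = (\<Sum>w\<in>neighbors v. ?t v w * wexp n w (\<lambda>p. F (v # p)))"
    using Suc.prems by (simp add: step_transition)
  also have "\<dots> = (\<Sum>w\<in>neighbors v. \<Sum>p\<in>paths n w.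
      ?t v w * (\<Prod>i<n. ?t (p ! i) (p ! Suc i)) * F (v # p))"
    by (intro sum.cong refl) (simp add: Suc.IH neighbors_verts sum_distrib_left mult.assoc)
  also have "\<dots> = (\<Sum>w\<in>neighbors v. \<Sum>p\<in>(#) v ` paths n w.
      (\<Prod>i<Suc n. ?t (p ! i) (p ! Suc i)) * F p)"
    by (rule sum.cong) (simp_all add: sum.reindex prod.lessThan_Suc_shift hd del: prod.lessThan_Suc)
  also have "\<dots> = (\<Sum>p\<in>paths (Suc n) v. (\<Prod>i<Suc n. ?t (p ! i) (p ! Suc i)) * F p)"
    unfolding paths.simps
    by (intro sum.UNION_disjoint[symmetric] ballI impI disj)
       (auto simp: finite_neighbors finite_paths neighbors_verts Suc.prems)
  finally show ?case .
qed simp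

end

subsection \<open>The law of the walk\<close>

lemma walk_path_eq_iff:
  "walk_path n \<omega> = p \<longleftrightarrow> length p = Suc n \<and> (\<forall>i\<le>n. \<omega> i = p ! i)"
proof -
  have "walk_path n \<omega> ! i = \<omega> i" if "i \<le> n" for i
    using that by (simp add: walk_path_def del: upt_Suc)
  moreover have "length (walk_path n \<omega>) = Suc n"
    by (simp add: walk_path_def)
  ultimately show ?thesis
    unfolding list_eq_iff_nth_eq less_Suc_eq_le by (metis less_Suc_eq_le)
qed

context locally_finite_network
begin

text \<open>Finite sets that serve twice: their union shows that \<open>verts G\<close> is
  countable, and they contain the support of \<open>kernel k\<close>.\<close>

primrec reach :: "nat \<Rightarrow> 'a \<Rightarrow> 'a set" where
  "reach 0 v = {v}"
| "reach (Suc k) v = (\<Union>w\<in>neighbors v. reach k w)"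

lemma finite_reach: "v \<in> verts G \<Longrightarrow> finite (reach k v)"
  by (induction k arbitrary: v) (auto simp: finite_neighbors neighbors_verts)

lemma reach_verts: "v \<in> verts G \<Longrightarrow> reach k v \<subseteq> verts G"
  using neighbors_verts by (induction k arbitrary: v) (simp, simp, blast)

text \<open>By connectedness the finite sets \<open>reach k x\<close> exhaust the graph.
  Countability allows the measurability of \<open>walk_path\<close> to be checked on single
  paths.\<close>

lemma countable_verts: "countable (verts G)"
proof -
  obtain x where x: "x \<in> verts G"
    using infinite_verts by (metis finite.emptyI ex_in_conv)
  have "u \<in> (\<Union>k. reach k x)" if u: "u \<in> verts G" for u
  proof -
    have "x \<rightarrow>\<^sup>*\<^bsub>mk_symmetric G\<^esub> u"
      using graph_connected x u unfolding Digraph_Component.connected_def strongly_connected_def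
      by simp
    from reachable_rtranclI[OF this] have "\<exists>k. u \<in> reach k x"
    proof (induction rule: converse_rtrancl_induct)
      case base
      show ?case by (rule exI[of _ 0]) simp
    next
      case (step v w)
      \<comment> \<open>Symmetrising the graph adds no new adjacency, because \<open>arev\<close>
        already supplies every reversed arc.\<close>
      then obtain a where "a \<in> arcs G" "tail G a = v \<and> head G a = w \<or> tail G a = w \<and> head G a = v"
        by (auto simp: parcs_mk_symmetric)
      then have "w \<in> neighbors v"
        unfolding neighbors_def
        by (auto simp: image_iff intro: bexI[of _ a] bexI[of _ "arev a"])
      with step.IH show ?case by (metis UN_I reach.simps(2))
    qed
    then show ?thesis by blast
  qed
  then have "verts G \<subseteq> (\<Union>k. reach k x)" by blast
  then show ?thesis
    by (rule countable_subset) (simp add: countable_finite finite_reach x)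
qed

lemma measurable_walk_path:
  assumes x: "x \<in> verts G"
  shows "walk_path n \<in> walk_law G c x \<rightarrow>\<^sub>M count_space (lists (verts G))"
proof -
  let ?M = "walk_law G c x"
  have coord: "(\<lambda>\<omega>. \<omega> i) \<in> ?M \<rightarrow>\<^sub>M count_space (verts G)" for i
    by (subst measurable_cong_sets[OF sets_walk_law[OF locally_finite_verts x] refl])
       (rule measurable_component_singleton, simp)
  have "{\<omega> \<in> space ?M. \<omega> i = a} \<in> sets ?M" for i a
    using measurable_sets[OF coord, of "{a} \<inter> verts G" i]
    by (rule back_subst[where P = "\<lambda>A. A \<in> sets ?M"])
       (auto simp: space_walk_law[OF locally_finite_verts x])
  then have "{\<omega> \<in> space ?M. \<forall>i\<in>{..n}. \<omega> i = p ! i} \<in> sets ?M" for p :: "'a list"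
    by (intro sets.sets_Collect_finite_All) auto
  moreover have "walk_path n -` {p} \<inter> space ?M =
      {\<omega> \<in> space ?M. length p = Suc n \<and> (\<forall>i\<in>{..n}. \<omega> i = p ! i)}" for p
    by (rule set_eqI)
      (simp only: vimage_singleton_eq Int_iff walk_path_eq_iff mem_Collect_eq Ball_def atMost_iff conj_ac)
  ultimately have "walk_path n -` {p} \<inter> space ?M \<in> sets ?M" for p
    by (cases "length p = Suc n") simp_all
  then show ?thesis
    unfolding measurable_count_space_eq_countable[OF countable_lists[OF countable_verts]]
    by (auto simp: walk_path_def space_walk_law[OF locally_finite_verts x] simp del: upt_Suc)
qed

lemma measure_walk_path:
  assumes x: "x \<in> verts G" and p: "p \<in> paths n x"
  shows "measure (walk_law G c x) (walk_path n -` {p} \<inter> space (walk_law G c x))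
    = (\<Prod>i<n. transition G c (p ! i) (p ! Suc i))"
proof -
  \<comment> \<open>\<open>walk_law_cylinder\<close> expects an infinite sequence of vertices, so
    the path is frozen at its last vertex after time \<open>n\<close>.\<close>
  let ?w = "\<lambda>i. p ! min i n"
  have len: "length p = Suc n" by (rule length_paths[OF p])
  have "walk_path n -` {p} \<inter> space (walk_law G c x)
      = {\<omega> \<in> space (walk_law G c x). \<forall>i\<le>n. \<omega> i = ?w i}"
    by (rule set_eqI)
      (simp add: vimage_singleton_eq walk_path_eq_iff len min_absorb1 conj_commute cong: conj_cong)
  moreover have "?w 0 = x" using paths_Cons[OF p] by (metis min_0L nth_Cons_0)
  moreover have "(\<Prod>i<n. transition G c (?w i) (?w (Suc i))) =
      (\<Prod>i<n. transition G c (p ! i) (p ! Suc i))"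
    by (intro prod.cong) (auto simp: min_def)
  ultimately show ?thesis
    using walk_law_cylinder[OF locally_finite_verts x, of ?w n] nth_paths_verts[OF x p]
    by simp
qed

text \<open>The finitely many paths in \<open>paths n x\<close> carry total mass 1, so almost
  everywhere the integrand is a finite combination of indicators.\<close>

lemma integral_walk_path:
  fixes F :: "'a list \<Rightarrow> real"
  assumes x: "x \<in> verts G"
  shows "(\<integral>\<omega>. F (walk_path n \<omega>) \<partial>walk_law G c x) = wexp n x F"
proof -
  let ?M = "walk_law G c x"
  let ?E = "\<lambda>p. walk_path n -` {p} \<inter> space ?M"
  interpret prob_space ?M by (rule prob_space_walk_law[OF locally_finite_verts x])
  have E: "?E p \<in> events" if "p \<in> paths n x" for p
    using set_paths[OF x that] by (intro measurable_sets[OF measurable_walk_path[OF x]]) auto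
  have fin: "finite (paths n x)" by (rule finite_paths[OF x])
  have "prob (\<Union>p\<in>paths n x. ?E p) = (\<Sum>p\<in>paths n x. prob (?E p))"
    using fin E by (intro finite_measure_finite_Union) (auto simp: disjoint_family_on_def)
  also have "\<dots> = wexp n x (\<lambda>_. 1)"
    by (simp add: measure_walk_path[OF x] wexp_eq_sum_paths[OF x])
  finally have "prob (\<Union>p\<in>paths n x. ?E p) = 1"
    by (simp add: wexp_const[OF x])
  moreover have "(\<Union>p\<in>paths n x. ?E p) \<in> events"
    using E by (intro sets.finite_UN fin) auto
  ultimately have AE: "AE \<omega> in ?M. \<omega> \<in> (\<Union>p\<in>paths n x. ?E p)"
    by (simp only: AE_in_set_eq_1)
  have "(\<integral>\<omega>. F (walk_path n \<omega>) \<partial>?M) = (\<integral>\<omega>. (\<Sum>p\<in>paths n x. F p * indicator (?E p) \<omega>) \<partial>?M)"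
  proof (rule integral_cong_AE)
    show "(\<lambda>\<omega>. F (walk_path n \<omega>)) \<in> borel_measurable ?M"
      by (rule measurable_compose[OF measurable_walk_path[OF x]]) simp
    show "(\<lambda>\<omega>. \<Sum>p\<in>paths n x. F p * indicator (?E p) \<omega>) \<in> borel_measurable ?M"
      using E by (intro borel_measurable_sum borel_measurable_times borel_measurable_indicator) auto
    show "AE \<omega> in ?M. F (walk_path n \<omega>) = (\<Sum>p\<in>paths n x. F p * indicator (?E p) \<omega>)"
      using AE
    proof eventually_elim
      case (elim \<omega>)
      then have "(\<Sum>p\<in>paths n x. F p * indicator (?E p) \<omega>) =
          (\<Sum>p\<in>paths n x. if p = walk_path n \<omega> then F p else 0)"
        by (intro sum.cong) (auto simp: indicator_def)
      also have "\<dots> = F (walk_path n \<omega>)" using elim fin by simp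
      finally show ?case ..
    qed
  qed
  also have "\<dots> = (\<Sum>p\<in>paths n x. F p * prob (?E p))"
    using E by (subst Bochner_Integration.integral_sum) (auto simp: less_top[symmetric] integrable_real_indicator intro!: integrable_mult_right)
  also have "\<dots> = wexp n x F"
    by (simp add: measure_walk_path[OF x] wexp_eq_sum_paths[OF x] mult.commute)
  finally show ?thesis .
qed

section \<open>Escape probabilities as limits over finite horizons\<close>

abbreviation escape :: "'a set \<Rightarrow> 'a \<Rightarrow> real" where
  "escape A v \<equiv> escape_prob G c v A"

text \<open>Continuity from above: escape is the intersection of the decreasing events of avoiding
  \<open>A\<close> at times 1 to N. The \<open>tl\<close> discards time 0, which
  \<open>return_time\<close> ignores.\<close>

lemma escape_tendsto:
  assumes v: "v \<in> verts G"
  shows "(\<lambda>N. wexp N v (\<lambda>p. of_bool (set (tl p) \<inter> A = {}))) \<longlonglongrightarrow> escape A v"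
proof -
  let ?M = "walk_law G c v"
  let ?B = "\<lambda>N. {\<omega> \<in> space ?M. set (tl (walk_path N \<omega>)) \<inter> A = {}}"
  interpret prob_space ?M by (rule prob_space_walk_law[OF locally_finite_verts v])
  have B: "?B N \<in> events" for N
  proof -
    have "walk_path N -` {p \<in> lists (verts G). set (tl p) \<inter> A = {}} \<inter> space ?M \<in> events"
      by (rule measurable_sets[OF measurable_walk_path[OF v]])
         (simp only: sets_count_space Pow_iff Collect_restrict)
    moreover have "walk_path N \<omega> \<in> lists (verts G)" if "\<omega> \<in> space ?M" for \<omega>
      using measurable_space[OF measurable_walk_path[OF v] that] by simp
    then have "walk_path N -` {p \<in> lists (verts G). set (tl p) \<inter> A = {}} \<inter> space ?M = ?B N"
      by blast
    ultimately show ?thesis by simp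
  qed
  have prob: "prob (?B N) = wexp N v (\<lambda>p. of_bool (set (tl p) \<inter> A = {}))" for N
  proof -
    have "prob (?B N) = (\<integral>\<omega>. indicator (?B N) \<omega> \<partial>?M)"
      using B[of N] by simp
    also have "\<dots> = (\<integral>\<omega>. of_bool (set (tl (walk_path N \<omega>)) \<inter> A = {}) \<partial>?M)"
      by (intro Bochner_Integration.integral_cong) (auto simp: indicator_def)
    finally show ?thesis
      using integral_walk_path[OF v, of "\<lambda>p. of_bool (set (tl p) \<inter> A = {})"] by simp
  qed
  have tl: "set (tl (walk_path N \<omega>)) = \<omega> ` {1..N}" for N and \<omega> :: "nat \<Rightarrow> 'a"
    by (simp add: walk_path_def map_tl[symmetric] atLeastLessThanSuc_atLeastAtMost del: upt_Suc)
  have "(\<lambda>N. prob (?B N)) \<longlonglongrightarrow> prob (\<Inter>N. ?B N)"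
  proof (rule finite_Lim_measure_decseq)
    show "range ?B \<subseteq> events" using B by blast
    have "{1..M} \<subseteq> {1..N}" if "M \<le> N" for M N :: nat using that by auto
    then show "decseq ?B" unfolding tl decseq_def by blast
  qed
  moreover have "(\<Inter>N. ?B N) = {\<omega> \<in> space ?M. return_time A \<omega> = \<infinity>}"
  proof -
    have escapes: "return_time A \<omega> = \<infinity> \<longleftrightarrow> (\<forall>t\<ge>1. \<omega> t \<notin> A)" for \<omega>
      unfolding return_time_def top_enat_def[symmetric] INF_top_conv by (auto simp: top_enat_def)
    have avoids: "(\<forall>t\<ge>1. \<omega> t \<notin> A) \<longleftrightarrow> (\<forall>N. \<omega> ` {1..N} \<inter> A = {})" for \<omega> :: "nat \<Rightarrow> 'a"
      by (fastforce simp: image_iff)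
    show ?thesis unfolding tl
      by (rule set_eqI)
        (simp only: INT_iff mem_Collect_eq escapes avoids ball_UNIV all_conj_distrib simp_thms)
  qed
  ultimately show ?thesis by (simp add: prob escape_prob_def)
qed

subsection \<open>Green function and capacity\<close>

text \<open>Unlike in \<open>escape\<close>, time 0 counts here, so \<open>1 - avoid A\<close> is
  the probability of hitting \<open>A\<close>.\<close>

definition avoid :: "'a set \<Rightarrow> 'a \<Rightarrow> real" where
  "avoid A v = (if v \<in> A then 0 else escape A v)"

definition avoid_upto :: "nat \<Rightarrow> 'a set \<Rightarrow> 'a \<Rightarrow> real" where
  "avoid_upto N A v = wexp N v (\<lambda>p. of_bool (set p \<inter> A = {}))"

lemma avoid_upto_eq:
  assumes "v \<in> verts G"
  shows "avoid_upto N A v = (if v \<in> A then 0 else wexp N v (\<lambda>p. of_bool (set (tl p) \<inter> A = {})))"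
proof -
  have "of_bool (set p \<inter> A = {}) = (if v \<in> A then 0 else of_bool (set (tl p) \<inter> A = {}) :: real)"
    if "p \<in> paths N v" for p
    by (subst paths_Cons[OF that, symmetric]) auto
  then have "avoid_upto N A v =
      wexp N v (\<lambda>p. if v \<in> A then 0 else of_bool (set (tl p) \<inter> A = {}))"
    unfolding avoid_upto_def by (rule wexp_cong)
  then show ?thesis by (simp add: wexp_const assms)
qed

lemma avoid_upto_Suc:
  assumes "v \<in> verts G"
  shows "avoid_upto (Suc N) A v = (if v \<in> A then 0 else step (avoid_upto N A) v)"
  unfolding avoid_upto_eq[OF assms] wexp.simps by (simp add: avoid_upto_def[abs_def])

lemma avoid_upto_tendsto:
  assumes "v \<in> verts G" shows "(\<lambda>N. avoid_upto N A v) \<longlonglongrightarrow> avoid A v"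
  using escape_tendsto[OF assms, of A] by (simp add: avoid_upto_eq[OF assms] avoid_def)

text \<open>First-step analysis: the identity holds by definition at every finite horizon and passes
  to the limit.\<close>

lemma escape_eq_step:
  assumes v: "v \<in> verts G" shows "escape A v = step (avoid A) v"
proof (rule LIMSEQ_unique)
  show "(\<lambda>N. wexp (Suc N) v (\<lambda>p. of_bool (set (tl p) \<inter> A = {}))) \<longlonglongrightarrow> escape A v"
    by (rule LIMSEQ_Suc[OF escape_tendsto[OF v]])
  have "(\<lambda>N. step (avoid_upto N A) v) \<longlonglongrightarrow> step (avoid A) v"
    by (intro step_tendsto avoid_upto_tendsto neighbors_verts)
  then show "(\<lambda>N. wexp (Suc N) v (\<lambda>p. of_bool (set (tl p) \<inter> A = {}))) \<longlonglongrightarrow> step (avoid A) v"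
    by (simp add: avoid_upto_def[abs_def])
qed

lemma escape_nonneg: "0 \<le> escape A v"
  by (simp add: escape_prob_def)

lemma avoid_nonneg: "0 \<le> avoid A v"
  by (simp add: avoid_def escape_nonneg)

lemma avoid_le_1:
  assumes "v \<in> verts G" shows "avoid A v \<le> 1"
  using prob_space.prob_le_1[OF prob_space_walk_law[OF locally_finite_verts assms]]
  by (simp add: avoid_def escape_prob_def)

lemma avoid_le_avoid_upto: "v \<in> verts G \<Longrightarrow> avoid A v \<le> avoid_upto N A v"
proof (induction N arbitrary: v)
  case 0
  then show ?case using avoid_le_1[of v A] by (auto simp: avoid_upto_def avoid_def)
next
  case (Suc N)
  have "step (avoid A) v \<le> step (avoid_upto N A) v"
    by (intro step_mono Suc.prems Suc.IH neighbors_verts)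
  then show ?case
    using Suc.prems by (simp add: avoid_upto_Suc avoid_def[of A v] escape_eq_step)
qed

text \<open>Markov's inequality for the number of visits to \<open>A\<close> at times 0 to N,
  obtained by induction on the first step.\<close>

lemma hit_upto_le_expected_visits:
  "v \<in> verts G \<Longrightarrow> 1 - avoid_upto N A v \<le> (\<Sum>k\<le>N. steps k (indicator A) v)"
proof (induction N arbitrary: v)
  case 0
  then show ?case by (simp add: avoid_upto_def indicator_def)
next
  case (Suc N)
  have "0 \<le> (\<Sum>k\<le>N. steps (Suc k) (indicator A :: 'a \<Rightarrow> real) v)"
    by (intro sum_nonneg steps_nonneg Suc.prems) auto
  moreover have "1 - step (avoid_upto N A) v \<le> (\<Sum>k\<le>N. steps (Suc k) (indicator A) v)"
  proof -
    have "1 - step (avoid_upto N A) v = step (\<lambda>w. 1 - avoid_upto N A w) v"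
      by (simp add: step_diff step_one Suc.prems)
    also have "\<dots> \<le> step (\<lambda>w. \<Sum>k\<le>N. steps k (indicator A) w) v"
      by (intro step_mono Suc.prems Suc.IH neighbors_verts)
    finally show ?thesis by (simp add: step_sum)
  qed
  ultimately show ?case
    by (cases "v \<in> A")
      (simp_all add: avoid_upto_Suc Suc.prems sum.atMost_Suc_shift del: sum.atMost_Suc)
qed

section \<open>The truncated Green function and the equilibrium potential\<close>

definition kernel :: "nat \<Rightarrow> 'a \<Rightarrow> 'a \<Rightarrow> real" where
  "kernel k x y = steps k (indicator {y}) x"

text \<open>Green's function of the first \<open>T\<close> steps, normalised so as to be symmetric.\<close>

definition green :: "nat \<Rightarrow> 'a \<Rightarrow> 'a \<Rightarrow> real" where
  "green T x y = (\<Sum>k<T. kernel k x y) / weight y"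

text \<open>On \<open>A\<close> this is the equilibrium measure. Off \<open>A\<close> it need not
  vanish, so sums of it must be confined to \<open>A\<close>.\<close>

definition charge :: "'a set \<Rightarrow> 'a \<Rightarrow> real" where
  "charge A v = weight v * escape A v"

lemma Cap_eq_sum_charge: "Cap G c A = sum (charge A) A"
  by (simp add: Cap_def charge_def)

lemma kernel_nonneg: "x \<in> verts G \<Longrightarrow> 0 \<le> kernel k x y"
  unfolding kernel_def by (intro steps_nonneg) auto

lemma green_nonneg: "x \<in> verts G \<Longrightarrow> y \<in> verts G \<Longrightarrow> 0 \<le> green T x y"
  unfolding green_def using weight_pos[of y] by (intro divide_nonneg_pos sum_nonneg kernel_nonneg)

lemma charge_nonneg: "v \<in> verts G \<Longrightarrow> 0 \<le> charge A v"
  using weight_pos[of v] by (simp add: charge_def escape_nonneg)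

text \<open>The charge is minus the Laplacian of \<open>avoid A\<close>, so the sum over time telescopes.\<close>

lemma green_charge:
  assumes A: "finite A" "A \<subseteq> verts G" and u: "u \<in> verts G"
  shows "(\<Sum>v\<in>A. green T u v * charge A v) = steps T (avoid A) u - avoid A u"
proof -
  have "(\<Sum>v\<in>A. green T u v * charge A v) = (\<Sum>v\<in>A. \<Sum>k<T. escape A v * kernel k u v)"
  proof (rule sum.cong[OF refl])
    fix v assume "v \<in> A"
    then have "weight v > 0" using A weight_pos by blast
    then show "green T u v * charge A v = (\<Sum>k<T. escape A v * kernel k u v)"
      by (simp add: green_def charge_def mult.commute flip: sum_distrib_left)
  qed
  also have "\<dots> = (\<Sum>k<T. \<Sum>v\<in>A. escape A v * kernel k u v)"
    by (rule sum.swap)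
  also have "\<dots> = (\<Sum>k<T. steps (Suc k) (avoid A) u - steps k (avoid A) u)"
  proof (rule sum.cong[OF refl])
    fix k
    have "(\<Sum>v\<in>A. escape A v * kernel k u v) =
        steps k (\<lambda>w. \<Sum>v\<in>A. escape A v * indicator {v} w) u"
      by (simp only: steps_sum steps_cmult kernel_def)
    \<comment> \<open>On \<open>A\<close> the function \<open>avoid A\<close> vanishes and its step
      is \<open>escape A\<close>; off \<open>A\<close> it is harmonic, so the difference is zero
      there.\<close>
    also have "\<dots> = steps k (\<lambda>w. step (avoid A) w - avoid A w) u"
    proof (rule steps_cong[OF _ u])
      fix w assume "w \<in> verts G"
      then show "(\<Sum>v\<in>A. escape A v * indicator {v} w) = step (avoid A) w - avoid A w"
        using A(1) by (simp add: avoid_def indicator_def if_distrib sum.delta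
            escape_eq_step[symmetric] cong: if_cong)
    qed
    also have "\<dots> = steps (Suc k) (avoid A) u - steps k (avoid A) u"
      by (simp only: steps_diff steps_Suc)
    finally show "(\<Sum>v\<in>A. escape A v * kernel k u v) =
        steps (Suc k) (avoid A) u - steps k (avoid A) u" .
  qed
  also have "\<dots> = steps T (avoid A) u - avoid A u"
    using sum_lessThan_telescope[of "\<lambda>k. steps k (avoid A) u" T] by simp
  finally show ?thesis .
qed

lemma steps_avoid_le_1:
  assumes "u \<in> verts G" shows "steps T (avoid A) u \<le> 1"
  using steps_mono[OF avoid_le_1 assms] steps_one[OF assms] by simp

text \<open>This bound on the potential controls the Green function in
  \<open>summable_kernel\<close> and the energy in \<open>wexp_Cap_LE_ge\<close>.\<close>

lemma green_charge_le_1: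
  assumes "finite A" "A \<subseteq> verts G" "u \<in> verts G"
  shows "(\<Sum>v\<in>A. green T u v * charge A v) \<le> 1"
  using green_charge[OF assms, of T] steps_avoid_le_1[OF assms(3), of T A] avoid_nonneg[of A u]
  by simp

text \<open>For the one-point set \<open>{v}\<close> the potential bound reads: expected visits to
  \<open>v\<close> times \<open>escape {v} v\<close> is at most 1. Transience makes the second
  factor positive.\<close>

lemma summable_kernel:
  assumes tr: "transient G c" and v: "v \<in> verts G" and u: "u \<in> verts G"
  shows "summable (\<lambda>k. kernel k u v)"
proof (rule summableI_nonneg_bounded)
  have esc: "escape {v} v > 0" using tr v by (simp add: transient_def)
  show "(\<Sum>k<T. kernel k u v) \<le> 1 / escape {v} v" for T
    using green_charge_le_1[of "{v}" u T] u v weight_pos[OF v] esc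
    by (simp add: green_def charge_def field_simps)
qed (rule kernel_nonneg[OF u])

text \<open>The difference from 1 is the probability of visiting \<open>A\<close> at time
  \<open>T\<close> or later. It is at most the expected number of such visits, which is the tail of
  a convergent series; the bound is proved at finite horizons and then passed to the limit.\<close>

lemma steps_avoid_tendsto:
  assumes tr: "transient G c" and A: "finite A" "A \<subseteq> verts G" and u: "u \<in> verts G"
  shows "(\<lambda>T. steps T (avoid A) u) \<longlonglongrightarrow> 1"
proof -
  define f where "f k = steps k (indicator A) u" for k
  have f_eq: "f k = (\<Sum>v\<in>A. kernel k u v)" for k
  proof -
    have "indicator A = (\<lambda>w. \<Sum>v\<in>A. indicator {v} w :: real)"
      using A(1) by (auto simp: fun_eq_iff indicator_def)
    then show ?thesis by (simp add: f_def steps_sum kernel_def)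
  qed
  then have f: "summable f"
    unfolding f_eq[abs_def] using A by (intro summable_sum summable_kernel[OF tr _ u]) auto
  have f_nonneg: "0 \<le> f k" for k
    unfolding f_def by (intro steps_nonneg u) auto
  have upper: "1 - steps T (avoid A) u \<le> (\<Sum>k. f (k + T))" for T
  proof (rule LIMSEQ_le_const2)
    show "(\<lambda>N. 1 - steps T (avoid_upto N A) u) \<longlonglongrightarrow> 1 - steps T (avoid A) u"
      by (intro tendsto_intros steps_tendsto avoid_upto_tendsto u)
    have "1 - steps T (avoid_upto N A) u \<le> (\<Sum>k. f (k + T))" for N
    proof -
      have "1 - steps T (avoid_upto N A) u = steps T (\<lambda>w. 1 - avoid_upto N A w) u"
        by (simp add: steps_diff steps_one u)
      also have "\<dots> \<le> steps T (\<lambda>w. \<Sum>k\<le>N. steps k (indicator A) w) u"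
        by (intro steps_mono hit_upto_le_expected_visits u)
      also have "\<dots> = (\<Sum>k\<le>N. f (k + T))"
        by (simp add: steps_sum f_def add.commute[of _ T] funpow_add)
      also have "\<dots> \<le> (\<Sum>k. f (k + T))"
        using f f_nonneg by (intro sum_le_suminf summable_ignore_initial_segment) auto
      finally show ?thesis .
    qed
    then show "\<exists>N. \<forall>n\<ge>N. 1 - steps T (avoid_upto n A) u \<le> (\<Sum>k. f (k + T))" by blast
  qed
  have lower: "1 - (\<Sum>k. f (k + T)) \<le> steps T (avoid A) u" for T
    using upper[of T] by linarith
  have "(\<lambda>T. \<Sum>k. f (k + T)) \<longlonglongrightarrow> 0"
    using tendsto_diff[OF tendsto_const[of "suminf f"] summable_LIMSEQ[OF f]]
    by (simp add: suminf_minus_initial_segment[OF f])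
  then have lim: "(\<lambda>T. 1 - (\<Sum>k. f (k + T))) \<longlonglongrightarrow> 1"
    using tendsto_diff[OF tendsto_const[of 1]] by fastforce
  show ?thesis
    by (rule tendsto_sandwich[OF _ _ lim tendsto_const])
       (intro always_eventually allI lower steps_avoid_le_1[OF u])+
qed

section \<open>Reversibility and positive semidefiniteness\<close>

lemma kernel_0: "kernel 0 x y = of_bool (x = y)"
  by (simp add: kernel_def indicator_def)

lemma kernel_Suc: "kernel (Suc k) x y = step (\<lambda>w. kernel k w y) x"
  by (simp add: kernel_def)

lemma kernel_eq_0: "y \<notin> reach k x \<Longrightarrow> kernel k x y = 0"
proof (induction k arbitrary: x)
  case (Suc k)
  then have "step (\<lambda>w. kernel k w y) x = step (\<lambda>w. 0) x"
    by (intro step_cong) auto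
  then show ?case by (simp add: kernel_Suc step_zero)
qed (auto simp: kernel_0)

text \<open>Any finite superset of the support may serve as index set, so that sums for different
  starting points can share one set.\<close>

lemma steps_eq_sum_kernel:
  assumes "finite Z" "reach k x \<subseteq> Z"
  shows "steps k f x = (\<Sum>z\<in>Z. kernel k x z * f z)"
  using assms(2)
proof (induction k arbitrary: x)
  case 0
  then show ?case using assms(1) by (simp add: kernel_0)
next
  case (Suc k)
  have "steps (Suc k) f x = step (steps k f) x" by simp
  also have "\<dots> = step (\<lambda>w. \<Sum>z\<in>Z. f z * kernel k w z) x"
    using Suc by (intro step_cong) (auto simp: mult.commute)
  also have "\<dots> = (\<Sum>z\<in>Z. kernel (Suc k) x z * f z)"
    by (simp add: step_sum step_cmult kernel_Suc mult.commute)
  finally show ?case .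
qed

text \<open>Both sides are total conductances of arcs between \<open>x\<close> and \<open>y\<close>,
  and \<open>arev\<close> exchanges the two directions while preserving conductances.\<close>

lemma kernel_1_reversible:
  assumes x: "x \<in> verts G" and y: "y \<in> verts G"
  shows "weight x * kernel 1 x y = weight y * kernel 1 y x"
proof -
  let ?E = "\<lambda>x y. {a \<in> arcs G. tail G a = x \<and> head G a = y}"
  have eq: "weight x * kernel 1 x y = sum c (?E x y)" if "x \<in> verts G" for x y
  proof -
    have "weight x * kernel 1 x y = (\<Sum>a\<in>out_arcs G x. c a * indicator {y} (head G a))"
      using weight_pos[OF that] by (simp add: kernel_def step_def sum_distrib_left)
    also have "\<dots> = (\<Sum>a\<in>?E x y. c a * indicator {y} (head G a))"
      using finite_out_arcs[OF that] by (intro sum.mono_neutral_right) (auto simp: indicator_def)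
    finally show ?thesis by simp
  qed
  have "arev ` ?E x y = ?E y x"
  proof
    have "a = arev (arev a) \<and> arev a \<in> ?E x y" if "a \<in> ?E y x" for a using that by simp
    then show "?E y x \<subseteq> arev ` ?E x y" by blast
  qed auto
  then have "sum c (?E y x) = sum (c \<circ> arev) (?E x y)"
    by (metis (no_types, lifting) sum.reindex inj_on_arev)
  also have "\<dots> = sum c (?E x y)"
    by (intro sum.cong) (auto simp: conductance_arev)
  finally show ?thesis by (simp only: eq[OF x] eq[OF y])
qed

text \<open>The step split off at the start of the walk from \<open>x\<close> becomes, by reversal,
  the last step of the walk from \<open>y\<close>.\<close>

lemma kernel_reversible:
  assumes "x \<in> verts G" "y \<in> verts G"
  shows "weight x * kernel k x y = weight y * kernel k y x"
  using assms
proof (induction k arbitrary: x y)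
  case 0
  then show ?case by (auto simp: kernel_0)
next
  case (Suc k)
  let ?Z = "reach 1 x \<union> reach k y"
  have Z: "finite ?Z" "?Z \<subseteq> verts G"
    using Suc.prems reach_verts finite_reach by blast+
  have "kernel (Suc k) x y = steps 1 (\<lambda>w. kernel k w y) x"
    by (simp add: kernel_Suc)
  also have "\<dots> = (\<Sum>z\<in>?Z. kernel 1 x z * kernel k z y)"
    by (rule steps_eq_sum_kernel[OF Z(1)]) blast
  finally have "weight x * kernel (Suc k) x y = (\<Sum>z\<in>?Z. (weight x * kernel 1 x z) * kernel k z y)"
    by (simp add: sum_distrib_left mult.assoc)
  also have "\<dots> = (\<Sum>z\<in>?Z. weight y * (kernel k y z * kernel 1 z x))"
  proof (rule sum.cong[OF refl])
    fix z assume "z \<in> ?Z"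
    then have z: "z \<in> verts G" using Z by blast
    have "(weight x * kernel 1 x z) * kernel k z y = kernel 1 z x * (weight z * kernel k z y)"
      using kernel_1_reversible[OF Suc.prems(1) z] by simp
    also have "\<dots> = kernel 1 z x * (weight y * kernel k y z)"
      using Suc.IH[OF z Suc.prems(2)] by simp
    finally show "(weight x * kernel 1 x z) * kernel k z y = weight y * (kernel k y z * kernel 1 z x)"
      by simp
  qed
  also have "\<dots> = weight y * steps k (\<lambda>w. kernel 1 w x) y"
    unfolding sum_distrib_left[symmetric] by (subst steps_eq_sum_kernel[OF Z(1)]) auto
  also have "steps k (\<lambda>w. kernel 1 w x) y = kernel (Suc k) y x"
    unfolding kernel_def steps_Suc by simp
  finally show ?case .
qed

lemma green_sym:
  assumes "x \<in> verts G" "y \<in> verts G"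
  shows "green T x y = green T y x"
proof -
  have "weight x * (\<Sum>k<T. kernel k x y) = weight y * (\<Sum>k<T. kernel k y x)"
    unfolding sum_distrib_left using kernel_reversible[OF assms] by (intro sum.cong) auto
  then show ?thesis
    using weight_pos[OF assms(1)] weight_pos[OF assms(2)] by (simp add: green_def field_simps)
qed

text \<open>I + P is positive semidefinite with respect to \<open>weight\<close>: the form is at
  least half the sum of the conductances times the squares of
  \<open>\<psi> (tail G a) + \<psi> (head G a)\<close>, over the arcs with tail in
  \<open>Z\<close>.\<close>

lemma dirichlet_nonneg:
  assumes Z: "finite Z" "Z \<subseteq> verts G" and \<psi>: "\<And>z. z \<notin> Z \<Longrightarrow> \<psi> z = 0"
  shows "0 \<le> (\<Sum>z\<in>Z. weight z * \<psi> z * (\<psi> z + step \<psi> z))"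
proof -
  let ?B = "\<Union>z\<in>Z. out_arcs G z"
  have fin: "finite ?B" using Z finite_out_arcs by blast
  have supp: "\<psi> z \<noteq> 0 \<Longrightarrow> z \<in> Z" for z using \<psi> by blast
  \<comment> \<open>Reversing the arcs turns heads into tails. Terms with tail outside
    \<open>Z\<close> vanish, so what remains is part of the sum over \<open>?B\<close>.\<close>
  have "(\<Sum>a\<in>?B. c a * (\<psi> (head G a))\<^sup>2) = (\<Sum>a\<in>arev ` ?B. c a * (\<psi> (tail G a))\<^sup>2)"
    by (subst sum.reindex[OF inj_on_arev]) (auto intro!: sum.cong simp: conductance_arev)
  also have "\<dots> = (\<Sum>a\<in>arev ` ?B \<inter> ?B. c a * (\<psi> (tail G a))\<^sup>2)"
    using fin by (intro sum.mono_neutral_right) (auto intro: supp)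
  also have "\<dots> \<le> (\<Sum>a\<in>?B. c a * (\<psi> (tail G a))\<^sup>2)"
    using fin by (intro sum_mono2 mult_nonneg_nonneg) (auto intro: less_imp_le[OF conductance_pos])
  finally have "(\<Sum>a\<in>?B. c a * (\<psi> (head G a))\<^sup>2) \<le> (\<Sum>a\<in>?B. c a * (\<psi> (tail G a))\<^sup>2)" .
  moreover have "0 \<le> (\<Sum>a\<in>?B. c a * (\<psi> (tail G a) + \<psi> (head G a))\<^sup>2)"
    by (intro sum_nonneg mult_nonneg_nonneg) (auto intro: less_imp_le[OF conductance_pos])
  moreover have "(\<Sum>a\<in>?B. c a * (\<psi> (tail G a) + \<psi> (head G a))\<^sup>2) =
      (\<Sum>a\<in>?B. c a * (\<psi> (tail G a))\<^sup>2) + (\<Sum>a\<in>?B. c a * (\<psi> (head G a))\<^sup>2)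
        + 2 * (\<Sum>a\<in>?B. c a * \<psi> (tail G a) * \<psi> (head G a))"
    by (simp add: power2_sum algebra_simps sum.distrib sum_distrib_left)
  ultimately have "0 \<le> (\<Sum>a\<in>?B. c a * (\<psi> (tail G a))\<^sup>2)
      + (\<Sum>a\<in>?B. c a * \<psi> (tail G a) * \<psi> (head G a))"
    by linarith
  also have "\<dots> = (\<Sum>a\<in>?B. c a * \<psi> (tail G a) * (\<psi> (tail G a) + \<psi> (head G a)))"
    by (simp add: algebra_simps power2_eq_square sum.distrib)
  also have "\<dots> = (\<Sum>z\<in>Z. \<Sum>a\<in>out_arcs G z. c a * \<psi> (tail G a) * (\<psi> (tail G a) + \<psi> (head G a)))"
    using Z finite_out_arcs by (intro sum.UNION_disjoint) auto
  also have "\<dots> = (\<Sum>z\<in>Z. weight z * \<psi> z * (\<psi> z + step \<psi> z))"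
  proof (rule sum.cong[OF refl])
    fix z assume "z \<in> Z"
    then have w: "weight z > 0" using Z weight_pos by blast
    have "(\<Sum>a\<in>out_arcs G z. c a * \<psi> (tail G a) * (\<psi> (tail G a) + \<psi> (head G a))) =
        (\<Sum>a\<in>out_arcs G z. c a * (\<psi> z * \<psi> z) + \<psi> z * (c a * \<psi> (head G a)))"
      by (intro sum.cong) (auto simp: algebra_simps)
    also have "\<dots> = weight z * (\<psi> z * \<psi> z) + \<psi> z * (weight z * step \<psi> z)"
    proof -
      have "weight z * step \<psi> z = (\<Sum>a\<in>out_arcs G z. c a * \<psi> (head G a))"
        using w by (simp add: step_def sum_distrib_left)
      then show ?thesis
        by (simp add: sum.distrib total_conductance_def sum_distrib_left sum_distrib_right)
    qed
    finally show "(\<Sum>a\<in>out_arcs G z. c a * \<psi> (tail G a) * (\<psi> (tail G a) + \<psi> (head G a))) =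
        weight z * \<psi> z * (\<psi> z + step \<psi> z)"
      by (simp add: algebra_simps)
  qed
  finally show ?thesis .
qed

text \<open>Odd powers of the transition operator need not be positive semidefinite, so they are paired
  with the even ones.\<close>

lemma green_pos_semidef:
  assumes S: "finite S" "S \<subseteq> verts G"
  shows "0 \<le> (\<Sum>x\<in>S. \<Sum>y\<in>S. f x * f y * green (2 * T) x y)"
proof -
  let ?K = "\<lambda>k x y. (kernel (2 * k) x y + kernel (Suc (2 * k)) x y) / weight y"
  have K: "0 \<le> (\<Sum>x\<in>S. \<Sum>y\<in>S. f x * f y * ?K k x y)" for k
  proof -
    define Z where "Z = (\<Union>x\<in>S. reach k x)"
    have Z: "finite Z" "Z \<subseteq> verts G"
      unfolding Z_def using S finite_reach reach_verts by (blast, blast)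
    \<comment> \<open>The paired powers form P^k (I + P) P^k. By reversibility both outer factors
      produce the same function \<open>\<psi>\<close>, which reduces the quadratic form to
      \<open>dirichlet_nonneg\<close>.\<close>
    define \<psi> where "\<psi> z = (\<Sum>x\<in>S. f x * kernel k x z) / weight z" for z
    have \<psi>_eq: "(\<Sum>x\<in>S. f x * (kernel k z x / weight x)) = \<psi> z" if z: "z \<in> verts G" for z
    proof -
      have "kernel k z x / weight x = kernel k x z / weight z" if "x \<in> S" for x
        using kernel_reversible[OF z, of x k] weight_pos[OF z] weight_pos[of x] that S
        by (auto simp: field_simps)
      then show ?thesis by (simp add: \<psi>_def sum_divide_distrib)
    qed
    have "?K k x y = (\<Sum>z\<in>Z. kernel k x z * ((kernel k z y + step (\<lambda>w. kernel k w y) z) / weight y))"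
      if "x \<in> S" for x y
    proof -
      have "kernel (2 * k) x y = steps k (\<lambda>w. kernel k w y) x"
        by (simp add: kernel_def mult_2 funpow_add)
      moreover have "kernel (Suc (2 * k)) x y = steps k (step (\<lambda>w. kernel k w y)) x"
        unfolding kernel_def steps_Suc[symmetric] by (simp add: mult_2 funpow_add)
      moreover have "reach k x \<subseteq> Z" using that by (auto simp: Z_def)
      ultimately show ?thesis
        by (simp add: steps_eq_sum_kernel[OF Z(1)] sum_divide_distrib add_divide_distrib
            distrib_left sum.distrib)
    qed
    then have "(\<Sum>x\<in>S. \<Sum>y\<in>S. f x * f y * ?K k x y) = (\<Sum>x\<in>S. \<Sum>y\<in>S. \<Sum>z\<in>Z.
        f x * kernel k x z * (f y * ((kernel k z y + step (\<lambda>w. kernel k w y) z) / weight y)))"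
      by (simp add: sum_distrib_left algebra_simps)
    also have "\<dots> = (\<Sum>x\<in>S. \<Sum>z\<in>Z. \<Sum>y\<in>S.
        f x * kernel k x z * (f y * ((kernel k z y + step (\<lambda>w. kernel k w y) z) / weight y)))"
      by (intro sum.cong refl sum.swap)
    also have "\<dots> = (\<Sum>z\<in>Z. \<Sum>x\<in>S. \<Sum>y\<in>S.
        f x * kernel k x z * (f y * ((kernel k z y + step (\<lambda>w. kernel k w y) z) / weight y)))"
      by (rule sum.swap)
    also have "\<dots> = (\<Sum>z\<in>Z. (\<Sum>x\<in>S. f x * kernel k x z) *
        (\<Sum>y\<in>S. f y * ((kernel k z y + step (\<lambda>w. kernel k w y) z) / weight y)))"
      by (simp add: sum_product)
    also have "\<dots> = (\<Sum>z\<in>Z. weight z * \<psi> z * (\<psi> z + step \<psi> z))"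
    proof (rule sum.cong[OF refl])
      fix z assume "z \<in> Z"
      then have z: "z \<in> verts G" using Z by blast
      have "(\<Sum>y\<in>S. f y * (step (\<lambda>w. kernel k w y) z / weight y)) =
          step (\<lambda>w. \<Sum>y\<in>S. f y * (kernel k w y / weight y)) z"
        by (simp add: step_sum step_cmult divide_inverse mult.commute[of "kernel k _ _"]
            mult.commute[of "step _ _"])
      also have "\<dots> = step \<psi> z"
        by (intro step_cong \<psi>_eq neighbors_verts)
      finally have "(\<Sum>y\<in>S. f y * ((kernel k z y + step (\<lambda>w. kernel k w y) z) / weight y)) =
          \<psi> z + step \<psi> z"
        using \<psi>_eq[OF z] by (simp add: add_divide_distrib distrib_left sum.distrib)
      moreover have "(\<Sum>x\<in>S. f x * kernel k x z) = weight z * \<psi> z"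
        using weight_pos[OF z] by (simp add: \<psi>_def)
      ultimately show "(\<Sum>x\<in>S. f x * kernel k x z) *
          (\<Sum>y\<in>S. f y * ((kernel k z y + step (\<lambda>w. kernel k w y) z) / weight y)) =
          weight z * \<psi> z * (\<psi> z + step \<psi> z)" by simp
    qed
    also have "\<dots> \<ge> 0"
    proof (rule dirichlet_nonneg[OF Z])
      fix z assume "z \<notin> Z"
      then show "\<psi> z = 0" by (simp add: \<psi>_def Z_def kernel_eq_0)
    qed
    finally show ?thesis .
  qed
  have "green (2 * T) x y = (\<Sum>k<T. ?K k x y)" for x y
    unfolding green_def sum_divide_distrib[symmetric]
    by (induction T) (simp_all add: add.assoc add_divide_distrib)
  then have "(\<Sum>x\<in>S. \<Sum>y\<in>S. f x * f y * green (2 * T) x y) =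
      (\<Sum>x\<in>S. \<Sum>y\<in>S. \<Sum>k<T. f x * f y * ?K k x y)"
    by (simp add: sum_distrib_left)
  also have "\<dots> = (\<Sum>k<T. \<Sum>x\<in>S. \<Sum>y\<in>S. f x * f y * ?K k x y)"
    by (subst sum.swap, subst (2) sum.swap) (simp add: sum.swap[of _ "{..<T}"])
  also have "\<dots> \<ge> 0"
    by (intro sum_nonneg K)
  finally show ?thesis .
qed

text \<open>Positivity is expanded at the charge of \<open>K\<close> minus \<open>s\<close> times
  \<open>\<nu>\<close>; the self-energy of the charge is at most its mass because its potential is
  at most 1. The horizon is even to suit \<open>green_pos_semidef\<close>. For a transient walk the
  bracket tends to the hitting probability as \<open>T\<close> grows.\<close>

lemma Cap_ge:
  fixes s :: real
  assumes S: "finite S" "S \<subseteq> verts G" and K: "K \<subseteq> S"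
  shows "Cap G c K \<ge> 2 * s * (\<Sum>v\<in>S. \<nu> v * (steps (2 * T) (avoid K) v - avoid K v))
      - s\<^sup>2 * (\<Sum>u\<in>S. \<Sum>v\<in>S. \<nu> u * \<nu> v * green (2 * T) u v)"
proof -
  define e where "e v = (if v \<in> K then charge K v else 0)" for v
  let ?g = "green (2 * T)"
  have finK: "finite K" "K \<subseteq> verts G" using S K by (auto intro: finite_subset)
  have pot: "(\<Sum>v\<in>S. ?g u v * e v) = steps (2 * T) (avoid K) u - avoid K u" if "u \<in> S" for u
  proof -
    have "(\<Sum>v\<in>S. ?g u v * e v) = (\<Sum>v\<in>K. ?g u v * charge K v)"
      using S K by (intro sum.mono_neutral_cong_right) (auto simp: e_def)
    then show ?thesis using green_charge[OF finK, of u "2 * T"] that S by auto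
  qed
  have sym: "(\<Sum>u\<in>S. \<Sum>v\<in>S. e u * \<nu> v * ?g u v) = (\<Sum>u\<in>S. \<Sum>v\<in>S. \<nu> u * e v * ?g u v)"
    using S by (subst sum.swap) (auto intro!: sum.cong simp: green_sym subset_iff)
  have bilin: "(\<Sum>u\<in>S. \<Sum>v\<in>S. h u * e v * ?g u v) =
      (\<Sum>u\<in>S. h u * (steps (2 * T) (avoid K) u - avoid K u))" for h
  proof (rule sum.cong[OF refl])
    fix u assume "u \<in> S"
    show "(\<Sum>v\<in>S. h u * e v * ?g u v) = h u * (steps (2 * T) (avoid K) u - avoid K u)"
      unfolding pot[OF \<open>u \<in> S\<close>, symmetric] sum_distrib_left by (simp add: mult_ac)
  qed
  have "0 \<le> (\<Sum>u\<in>S. \<Sum>v\<in>S. (e u - s * \<nu> u) * (e v - s * \<nu> v) * ?g u v)"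
    by (rule green_pos_semidef[OF S])
  also have "\<dots> = (\<Sum>u\<in>S. \<Sum>v\<in>S. e u * e v * ?g u v) - s * (\<Sum>u\<in>S. \<Sum>v\<in>S. e u * \<nu> v * ?g u v)
      - s * (\<Sum>u\<in>S. \<Sum>v\<in>S. \<nu> u * e v * ?g u v) + s\<^sup>2 * (\<Sum>u\<in>S. \<Sum>v\<in>S. \<nu> u * \<nu> v * ?g u v)"
    by (simp add: algebra_simps power2_eq_square sum.distrib sum_subtractf sum_distrib_left)
  also have "\<dots> = (\<Sum>u\<in>S. e u * (steps (2 * T) (avoid K) u - avoid K u))
      - 2 * s * (\<Sum>v\<in>S. \<nu> v * (steps (2 * T) (avoid K) v - avoid K v))
      + s\<^sup>2 * (\<Sum>u\<in>S. \<Sum>v\<in>S. \<nu> u * \<nu> v * ?g u v)"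
    unfolding sym bilin by simp
  also have "(\<Sum>u\<in>S. e u * (steps (2 * T) (avoid K) u - avoid K u)) \<le> sum e S"
  proof (rule sum_mono)
    fix u assume "u \<in> S"
    then have u: "u \<in> verts G" using S by blast
    have "e u * (steps (2 * T) (avoid K) u - avoid K u) \<le> e u * 1"
      using steps_avoid_le_1[OF u, of "2 * T" K] avoid_nonneg[of K u] charge_nonneg[OF u]
      by (intro mult_left_mono) (auto simp: e_def)
    then show "e u * (steps (2 * T) (avoid K) u - avoid K u) \<le> e u" by simp
  qed
  also have "sum e S = Cap G c K"
    unfolding Cap_eq_sum_charge e_def using S K
    by (intro sum.mono_neutral_cong_right) auto
  finally show ?thesis by simp
qed

end

subsection \<open>Capacity of the loop-erased walk\<close>

text \<open>Counting each vertex at its first visit turns a sum over the trace of a path into a sum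
  over times, to which conditioning applies.\<close>

lemma sum_first_visits:
  "(\<Sum>m<length p. if p ! m \<in> set (take m p) then 0 else f (p ! m)) = (sum f (set p) :: real)"
proof (induction p rule: rev_induct)
  case (snoc v p)
  have "(\<Sum>m<length p. if (p @ [v]) ! m \<in> set (take m (p @ [v])) then 0 else f ((p @ [v]) ! m)) =
      (\<Sum>m<length p. if p ! m \<in> set (take m p) then 0 else f (p ! m))"
    by (intro sum.cong) (auto simp: nth_append)
  with snoc show ?case by (simp add: insert_absorb)
qed simp

text \<open>Integration against the image under \<open>y\<close> of the weights
  \<open>a\<close>.\<close>

lemma sum_push_forward:
  fixes a h :: "_ \<Rightarrow> real"
  assumes "finite S" "\<And>i. i \<in> I \<Longrightarrow> y i \<in> S"
  shows "(\<Sum>v\<in>S. (\<Sum>i\<in>I. a i * of_bool (y i = v)) * h v) = (\<Sum>i\<in>I. a i * h (y i))"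
proof -
  have "(\<Sum>v\<in>S. (\<Sum>i\<in>I. a i * of_bool (y i = v)) * h v) =
      (\<Sum>i\<in>I. \<Sum>v\<in>S. a i * of_bool (y i = v) * h v)"
    unfolding sum_distrib_right by (rule sum.swap)
  also have "\<dots> = (\<Sum>i\<in>I. a i * h (y i))"
  proof (rule sum.cong[OF refl])
    fix i assume "i \<in> I"
    have "(\<Sum>v\<in>S. a i * of_bool (y i = v) * h v) = (\<Sum>v\<in>S. if y i = v then a i * h v else 0)"
      by (intro sum.cong) auto
    then show "(\<Sum>v\<in>S. a i * of_bool (y i = v) * h v) = a i * h (y i)"
      using assms \<open>i \<in> I\<close> by simp
  qed
  finally show ?thesis .
qed

context locally_finite_network
begin

text \<open>Here \<open>q\<close> is the future of the walk and \<open>q'\<close> an independent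
  copy. Exchanging them preserves their joint law, so with probability at least 1/2 the copy meets
  \<open>LE s\<close> no later than the future does, and \<open>hit_LE_append\<close>
  applies.\<close>

lemma wexp_hit_LE_ge_half:
  assumes s: "s \<noteq> []" and z: "last s \<in> verts G"
  shows "1 / 2 \<le> wexp N (last s) (\<lambda>q. wexp N (last s) (\<lambda>q'.
    of_bool (set q' \<inter> set (LE (s @ tl q)) \<noteq> {})))" (is "_ \<le> ?H")
proof -
  let ?E = "wexp N (last s)"
  let ?j = "\<lambda>q. first_hit (LE s) (set q)"
  define D where "D = ?E (\<lambda>q. ?E (\<lambda>q'. of_bool (?j q' \<le> ?j q)))"
  have "D = ?E (\<lambda>q. ?E (\<lambda>q'. of_bool (?j q \<le> ?j q')))"
    unfolding D_def by (rule wexp_swap)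
  \<comment> \<open>At least one of the two comparisons always holds; ties count twice.\<close>
  then have "D + D = ?E (\<lambda>q. ?E (\<lambda>q'. of_bool (?j q' \<le> ?j q) + of_bool (?j q \<le> ?j q')))"
    by (simp add: D_def wexp_add)
  also have "\<dots> \<ge> ?E (\<lambda>q. ?E (\<lambda>q'. 1))"
    by (intro wexp_mono z) auto
  finally have "1 / 2 \<le> D" by (simp add: wexp_const z)
  also have "D \<le> ?H"
    unfolding D_def
  proof (intro wexp_mono z)
    fix q q' assume q: "q \<in> paths N (last s)" "q' \<in> paths N (last s)"
    then have "q \<noteq> []" "last s \<in> set q'"
      using paths_nonempty[of N "last s"] paths_Cons[OF q(2)] by (auto, metis list.set_intros(1))
    then show "of_bool (?j q' \<le> ?j q) \<le> (of_bool (set q' \<inter> set (LE (s @ tl q)) \<noteq> {}) :: real)"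
      using hit_LE_append[OF s, of q "set q'"] by simp
  qed
  finally show ?thesis .
qed

text \<open>The copy runs for \<open>n - m\<close> steps, exactly as long as the future, as the
  symmetry requires. Hitting within this horizon is at most as likely as hitting at all.\<close>

lemma wcond_hit_LE_ge_half:
  assumes x: "x \<in> verts G" and m: "m \<le> n" and p: "p \<in> paths n x"
  shows "1 / 2 \<le> wcond n m (\<lambda>r. 1 - avoid (set (LE r)) (r ! m)) p"
proof -
  let ?s = "take (Suc m) p" and ?N = "n - m"
  have len: "length p = Suc n" by (rule length_paths[OF p])
  then have s: "?s \<noteq> []" "last ?s = p ! m" "(?s @ t) ! m = p ! m" for t
    using m by (auto simp: take_Suc_conv_app_nth nth_append)
  have z: "p ! m \<in> verts G" by (rule nth_paths_verts[OF x p m])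
  have "1 / 2 \<le> wexp ?N (p ! m) (\<lambda>q. wexp ?N (p ! m) (\<lambda>q'.
      of_bool (set q' \<inter> set (LE (?s @ tl q)) \<noteq> {})))"
    using wexp_hit_LE_ge_half[of ?s ?N] z s(1,2) by simp
  also have "\<dots> \<le> wexp ?N (p ! m) (\<lambda>q. 1 - avoid (set (LE (?s @ tl q))) (p ! m))"
  proof (rule wexp_mono[OF z])
    fix q
    let ?K = "set (LE (?s @ tl q))"
    have "(\<lambda>q'. of_bool (set q' \<inter> ?K \<noteq> {}) :: real) = (\<lambda>q'. 1 - of_bool (set q' \<inter> ?K = {}))"
      by auto
    then have "wexp ?N (p ! m) (\<lambda>q'. of_bool (set q' \<inter> ?K \<noteq> {})) = 1 - avoid_upto ?N ?K (p ! m)"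
      by (simp add: wexp_diff wexp_const[OF z] avoid_upto_def)
    then show "wexp ?N (p ! m) (\<lambda>q'. of_bool (set q' \<inter> ?K \<noteq> {})) \<le> 1 - avoid ?K (p ! m)"
      using avoid_le_avoid_upto[OF z, of ?K ?N] by simp
  qed
  also have "\<dots> = wcond n m (\<lambda>r. 1 - avoid (set (LE r)) (r ! m)) p"
    unfolding wcond_def s(3) ..
  finally show ?thesis .
qed

text \<open>The charge depends on the whole path through \<open>set p\<close>, hence the need to
  condition on the first \<open>m\<close> steps later. Restricting to first visits makes the sum
  over times equal to the capacity.\<close>

definition visit_charge :: "nat \<Rightarrow> 'a list \<Rightarrow> real" where
  "visit_charge m p = (if p ! m \<in> set (take m p) then 0 else charge (set p) (p ! m))"

lemma sum_visit_charge:
  "length p = Suc n \<Longrightarrow> (\<Sum>m\<le>n. h (p ! m) * visit_charge m p) = (\<Sum>v\<in>set p. h v * charge (set p) v)"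
  using sum_first_visits[of p "\<lambda>v. h v * charge (set p) v"]
  by (simp add: visit_charge_def lessThan_Suc_atMost if_distrib cong: if_cong)

lemma wexp_Cap_LE_ge:
  assumes tr: "transient G c" and x: "x \<in> verts G"
  shows "wexp n x (\<lambda>p. Cap G c (set (LE p))) \<ge> 1 / 8 * wexp n x (\<lambda>p. Cap G c (set p))"
proof -
  let ?E = "wexp n x"
  define C where "C = ?E (\<lambda>p. Cap G c (set p))"
  define M where "M m = wcond n m (visit_charge m)" for m
  have M_nonneg: "0 \<le> M m p" if "m \<le> n" "p \<in> paths n x" for m p
    unfolding M_def wcond_def
    using nth_paths_verts[OF x that(2,1)] length_paths[OF that(2)] that(1)
    by (intro wexp_nonneg) (auto simp: visit_charge_def charge_nonneg nth_append)
  have M_take: "M m (take (Suc l) p) = M m p" if "m \<le> l" for m l p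
    using that by (simp add: M_def wcond_take)
  have E_M: "?E (\<lambda>p. A p * M m p) = ?E (\<lambda>p. A p * visit_charge m p)"
    if "m \<le> n" "\<And>p. A (take (Suc m) p) = A p" for A m
    unfolding M_def by (rule wexp_wcond[where A = A, OF that(1) x that(2)])
  have total: "(\<Sum>m\<le>n. ?E (M m)) = C"
  proof -
    have "(\<Sum>m\<le>n. ?E (M m)) = ?E (\<lambda>p. \<Sum>m\<le>n. visit_charge m p)"
      unfolding wexp_sum using E_M[of _ "\<lambda>_. 1"] by (intro sum.cong) simp_all
    also have "\<dots> = C"
      unfolding C_def Cap_eq_sum_charge
      using sum_visit_charge[of _ n "\<lambda>_. 1"] by (intro wexp_cong) (simp add: length_paths)
    finally show ?thesis .
  qed

  \<comment> \<open>For \<open>m \<le> l\<close> everything except \<open>M l\<close> is known at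
    time \<open>l\<close> once the path so far is given, so the tower property replaces
    \<open>M l\<close> by the charge itself. Summing over \<open>l\<close> then leaves a potential,
    which is at most 1.\<close>
  have energy: "?E (\<lambda>p. \<Sum>m\<le>n. \<Sum>l\<le>n. M m p * M l p * green T (p ! m) (p ! l)) \<le> 2 * C" for T
  proof -
    define B where "B m l = ?E (\<lambda>p. M m p * green T (p ! m) (p ! l) * visit_charge l p)" for m l
    have B_nonneg: "0 \<le> B m l" if "m \<le> n" "l \<le> n" for m l
      unfolding B_def using that
      by (intro wexp_nonneg x mult_nonneg_nonneg M_nonneg green_nonneg)
        (auto simp: visit_charge_def nth_paths_verts[OF x] charge_nonneg)
    have row: "(\<Sum>l\<le>n. B m l) \<le> ?E (M m)" if m: "m \<le> n" for m
    proof -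
      have "(\<Sum>l\<le>n. B m l) = ?E (\<lambda>p. M m p * (\<Sum>l\<le>n. green T (p ! m) (p ! l) * visit_charge l p))"
        unfolding B_def wexp_sum[symmetric] by (simp add: sum_distrib_left mult.assoc)
      also have "\<dots> \<le> ?E (\<lambda>p. M m p * 1)"
      proof (intro wexp_mono x mult_left_mono M_nonneg m)
        fix p assume p: "p \<in> paths n x"
        show "(\<Sum>l\<le>n. green T (p ! m) (p ! l) * visit_charge l p) \<le> 1"
          unfolding sum_visit_charge[OF length_paths[OF p]]
          by (intro green_charge_le_1 set_paths[OF x p] nth_paths_verts[OF x p m]) simp
      qed
      finally show ?thesis by simp
    qed
    have le: "?E (\<lambda>p. M m p * M l p * green T (p ! m) (p ! l)) = B m l"
      if "m \<le> l" "l \<le> n" for m l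
    proof -
      have "?E (\<lambda>p. M m p * M l p * green T (p ! m) (p ! l)) =
          ?E (\<lambda>p. M m p * green T (p ! m) (p ! l) * M l p)"
        by (simp add: mult_ac)
      then show ?thesis
        unfolding B_def using E_M[OF that(2), of "\<lambda>p. M m p * green T (p ! m) (p ! l)"] that
        by (simp add: M_take)
    qed
    \<comment> \<open>The left side equals \<open>B m l\<close> or \<open>B l m\<close>, according
      to which index is later; adding both costs the factor 2 in the energy bound.\<close>
    have "?E (\<lambda>p. M m p * M l p * green T (p ! m) (p ! l)) \<le> B m l + B l m"
      if ml: "m \<le> n" "l \<le> n" for m l
    proof (cases "m \<le> l")
      case True
      then show ?thesis using le[OF True ml(2)] B_nonneg[OF ml(2,1)] by simp
    next
      case False
      have "?E (\<lambda>p. M m p * M l p * green T (p ! m) (p ! l)) =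
          ?E (\<lambda>p. M l p * M m p * green T (p ! l) (p ! m))"
        using ml by (intro wexp_cong) (simp add: green_sym nth_paths_verts[OF x] mult.commute)
      then show ?thesis using False le[of l m] ml B_nonneg[OF ml] by simp
    qed
    then have "(\<Sum>m\<le>n. \<Sum>l\<le>n. ?E (\<lambda>p. M m p * M l p * green T (p ! m) (p ! l))) \<le>
        (\<Sum>m\<le>n. \<Sum>l\<le>n. B m l + B l m)"
      by (intro sum_mono) simp
    also have "\<dots> = 2 * (\<Sum>m\<le>n. \<Sum>l\<le>n. B m l)"
      by (simp add: sum.distrib sum.swap[of "\<lambda>m l. B l m"])
    also have "\<dots> \<le> 2 * C"
      unfolding total[symmetric] by (intro mult_left_mono sum_mono row) simp_all
    finally show ?thesis by (simp add: wexp_sum)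
  qed

  have hit: "1 / 2 * ?E (M m) \<le> ?E (\<lambda>p. M m p * (1 - avoid (set (LE p)) (p ! m)))"
    if m: "m \<le> n" for m
  proof -
    let ?F = "\<lambda>p. 1 - avoid (set (LE p)) (p ! m)"
    have "1 / 2 * ?E (M m) = ?E (\<lambda>p. M m p * (1 / 2))"
      unfolding wexp_cmult[symmetric] by (simp add: mult.commute)
    also have "\<dots> \<le> ?E (\<lambda>p. M m p * wcond n m ?F p)"
      using m by (intro wexp_mono x mult_left_mono wcond_hit_LE_ge_half[OF x] M_nonneg)
    \<comment> \<open>\<open>M m\<close> is determined by the first \<open>m\<close> steps, so the
      conditioning can be undone.\<close>
    also have "\<dots> = ?E (\<lambda>p. M m p * ?F p)"
      by (rule wexp_wcond[where A = "M m", OF m x M_take]) simp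
    finally show ?thesis .
  qed

  \<comment> \<open>The hitting term at a finite horizon, as \<open>Cap_ge\<close> provides it; the
    horizon goes to infinity only after expectations have been taken.\<close>
  define R where
    "R T m = ?E (\<lambda>p. M m p * (steps T (avoid (set (LE p))) (p ! m) - avoid (set (LE p)) (p ! m)))"
    for T m
  have lower: "1 / 2 * (\<Sum>m\<le>n. R (2 * T) m) - 1 / 8 * C \<le> ?E (\<lambda>p. Cap G c (set (LE p)))" for T
  proof -
    let ?I = "\<lambda>p. \<Sum>m\<le>n. \<Sum>l\<le>n. M m p * M l p * green (2 * T) (p ! m) (p ! l)"
    let ?J = "\<lambda>p. \<Sum>m\<le>n. M m p * (steps (2 * T) (avoid (set (LE p))) (p ! m) - avoid (set (LE p)) (p ! m))"
    have "1 / 2 * ?J p - 1 / 16 * ?I p \<le> Cap G c (set (LE p))" if p: "p \<in> paths n x" for p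
    proof -
      define \<nu> where "\<nu> v = (\<Sum>m\<le>n. M m p * of_bool (p ! m = v))" for v
      have on: "p ! m \<in> set p" if "m \<in> {..n}" for m
        using that length_paths[OF p] by simp
      have push: "(\<Sum>v\<in>set p. \<nu> v * h v) = (\<Sum>m\<le>n. M m p * h (p ! m))" for h
        unfolding \<nu>_def by (rule sum_push_forward[OF _ on]) simp
      have "(\<Sum>u\<in>set p. \<Sum>v\<in>set p. \<nu> u * \<nu> v * green (2 * T) u v) =
          (\<Sum>u\<in>set p. \<nu> u * (\<Sum>v\<in>set p. \<nu> v * green (2 * T) u v))"
        by (simp add: sum_distrib_left mult.assoc)
      also have "\<dots> = ?I p"
        unfolding push by (simp add: sum_distrib_left mult.assoc)
      finally have I: "(\<Sum>u\<in>set p. \<Sum>v\<in>set p. \<nu> u * \<nu> v * green (2 * T) u v) = ?I p" .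
      have "p \<noteq> []" using paths_nonempty[of n x] p by auto
      then have "set (LE p) \<subseteq> set p" by (rule set_LE_subset)
      \<comment> \<open>With hitting term at least C / 2 in the limit and energy at most 2 C, the
        bound is s C - 2 s^2 C, which is maximal at s = 1/4 with value C / 8.\<close>
      from Cap_ge[OF _ set_paths[OF x p] this, of "1 / 4" \<nu> T] show ?thesis
        unfolding I push by (simp add: power2_eq_square)
    qed
    then have "?E (\<lambda>p. 1 / 2 * ?J p - 1 / 16 * ?I p) \<le> ?E (\<lambda>p. Cap G c (set (LE p)))"
      by (intro wexp_mono x)
    moreover have "?E ?J = (\<Sum>m\<le>n. R (2 * T) m)"
      by (simp add: R_def wexp_sum)
    ultimately show ?thesis
      using energy[of "2 * T"] by (simp only: wexp_diff wexp_cmult)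
  qed
  have "(\<lambda>T. R T m) \<longlonglongrightarrow> ?E (\<lambda>p. M m p * (1 - avoid (set (LE p)) (p ! m)))"
    if "m \<le> n" for m
    unfolding R_def
  proof (intro wexp_tendsto tendsto_intros steps_avoid_tendsto tr)
    fix p assume p: "p \<in> paths n x"
    have "p \<noteq> []" using paths_nonempty[of n x] p by auto
    then show "set (LE p) \<subseteq> verts G" using set_LE_subset set_paths[OF x p] by blast
    show "p ! m \<in> verts G" by (rule nth_paths_verts[OF x p that])
  qed simp
  then have "(\<lambda>T. R (2 * T) m) \<longlonglongrightarrow> ?E (\<lambda>p. M m p * (1 - avoid (set (LE p)) (p ! m)))"
    if "m \<le> n" for m
    using LIMSEQ_subseq_LIMSEQ[of "\<lambda>T. R T m" _ "(*) 2"] that by (simp add: o_def strict_mono_def)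
  then have "(\<lambda>T. 1 / 2 * (\<Sum>m\<le>n. R (2 * T) m) - 1 / 8 * C) \<longlonglongrightarrow>
      1 / 2 * (\<Sum>m\<le>n. ?E (\<lambda>p. M m p * (1 - avoid (set (LE p)) (p ! m)))) - 1 / 8 * C"
    by (intro tendsto_intros) simp
  then have "1 / 2 * (\<Sum>m\<le>n. ?E (\<lambda>p. M m p * (1 - avoid (set (LE p)) (p ! m)))) - 1 / 8 * C
      \<le> ?E (\<lambda>p. Cap G c (set (LE p)))"
    by (rule LIMSEQ_le_const2) (use lower in blast)
  moreover have "1 / 2 * C \<le> (\<Sum>m\<le>n. ?E (\<lambda>p. M m p * (1 - avoid (set (LE p)) (p ! m))))"
    unfolding total[symmetric] sum_distrib_left by (intro sum_mono hit) simp
  ultimately show ?thesis unfolding C_def by linarith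
qed

lemma wexp_Cap_nonneg:
  assumes "x \<in> verts G" shows "0 \<le> wexp n x (\<lambda>p. Cap G c (set p))"
  using set_paths[OF assms] unfolding Cap_eq_sum_charge
  by (intro wexp_nonneg assms sum_nonneg charge_nonneg) blast

end

theorem theorem3p1:
  fixes G :: "('v, 'e) pre_digraph" and arev :: "'e \<Rightarrow> 'e" and c :: "'e \<Rightarrow> real"
    and x :: 'v and n :: nat
  assumes "network G arev c"
    and "locally_finite G"
    and "transient G c"
    and "x \<in> verts G"
  shows "(\<integral>\<omega>. Cap G c (set (LE (walk_path n \<omega>))) \<partial>walk_law G c x)
    \<ge> 1 / 256 * (\<integral>\<omega>. Cap G c (set (walk_path n \<omega>)) \<partial>walk_law G c x)"
proof -
  interpret locally_finite_network G arev c
    using assms(1,2) by (simp add: locally_finite_network_def locally_finite_network_axioms_def)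
  show ?thesis
    \<comment> \<open>The factor 1/8 may be lowered to 1/256 because the expected capacity is
      nonnegative.\<close>
    using wexp_Cap_LE_ge[OF assms(3,4), of n] wexp_Cap_nonneg[OF assms(4), of n]
    by (simp add: integral_walk_path[OF assms(4), of "\<lambda>p. Cap G c (set p)"]
        integral_walk_path[OF assms(4), of "\<lambda>p. Cap G c (set (LE p))"])
qed

end
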